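(* Let $d\ge 1$, $m>1$, $m^\ast:=m/(m-1)$, and let $(b,V)$ satisfy the structural assumptions listed in the context (moderate drift, $\delta=0$) with constants $\rho>0$, $R>0$, $a\in\mathbf{R}$, $\eta>0$. Let $\overline{\lambda}_{\max}:=\lim_{\beta\to\infty}\lambda_{\max}(\beta)$. Then $\overline{\lambda}_{\max}=\rho^{m^\ast}/m^\ast$. Moreover: (i) If $0<\eta\le 1$ or $a\ge d-1$, then there exists $\beta_0>0$ such that $\lambda_{\max}(\beta)=\overline{\lambda}_{\max}$ for all $\beta\ge\beta_0$. (ii) If $\eta>1$ and $a<d-1$, then $\lambda_{\max}(\beta)<\overline{\lambda}_{\max}$ for every $\beta\ge 0$.
   Context: For $r>0$, $B_r:=\{x\in\mathbf{R}^d : |x|<r\}$, and $\overline{B}_r$ is its closure. $D\phi$ and $\Delta\phi$ denote the gradient and Laplacian of $\phi$. For $\beta\ge 0$ consider the equation $$\text{(EP)}\qquad \lambda-\Delta\phi(x)+b(x)\cdot D\phi(x)+\frac1m|D\phi(x)|^m-\beta V(x)=0,\qquad x\in\mathbf{R}^d.$$ A pair $(\lambda,\phi)\in\mathbf{R}\times C^3(\mathbf{R}^d)$ is a subsolution of (EP) if the left-hand side is $\le 0$ for every $x\in\mathbf{R}^d$. The generalized principal eigenvalue is $$\lambda_{\max}(\beta):=\sup\{\lambda\in\mathbf{R} : \text{(EP) has a subsolution } (\lambda,\phi)\in\mathbf{R}\times C^3(\mathbf{R}^d)\}.$$ The function $\beta\mapsto\lambda_{\max}(\beta)$ is non-decreasing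 on $[0,\infty)$, so its limit as $\beta\to\infty$ exists in $(-\infty,+\infty]$. Structural assumptions on $(b,V)$: $b\in C^2(\mathbf{R}^d,\mathbf{R}^d)$, $V\in C^2(\mathbf{R}^d)$, $DV\in L^\infty(\mathbf{R}^d,\mathbf{R}^d)$, and - $b(x)=(\rho+a|x|^{-1})|x|^{-1}x$ for all $x\notin B_R$; - $V(x)\ge 0$ for all $x\in\mathbf{R}^d$, $V(x)>0$ for all $x\in\overline{B}_R$, and $V(x)=|x|^{-\eta}$ for all $x\notin B_R$. *)

theory Defs
  imports "HOL-Analysis.Analysis"
begin

text \<open>
  The space \<open>\<real>\<^sup>d\<close> is an arbitrary type \<open>'a\<close> of class \<open>euclidean_space\<close>, with \<open>d = DIM('a)\<close>
  (so \<open>d \<ge> 1\<close> is built in).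
\<close>

text \<open>\<open>Ck k f\<close>: the function \<open>f\<close> is of class \<open>C\<^sup>k\<close> on the whole space, i.e. all its iterated
  directional derivatives up to order \<open>k\<close> exist and are continuous.\<close>

primrec Ck :: "nat \<Rightarrow> ('a::euclidean_space \<Rightarrow> 'b::real_normed_vector) \<Rightarrow> bool" where
  "Ck 0 f \<longleftrightarrow> continuous_on UNIV f"
| "Ck (Suc k) f \<longleftrightarrow>
     (\<forall>x. f differentiable (at x)) \<and> (\<forall>v. Ck k (\<lambda>x. frechet_derivative f (at x) v))"

definition gradient :: "('a::euclidean_space \<Rightarrow> real) \<Rightarrow> 'a \<Rightarrow> 'a" where
  "gradient f x = (THE g. GDERIV f x :> g)"

lemma gradient_eqI:
  assumes "GDERIV f x :> g"
  shows "gradient f x = g"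
  unfolding gradient_def
proof (rule the_equality)
  fix h assume "GDERIV f x :> h"
  then have "(\<lambda>v. v \<bullet> h) = (\<lambda>v. v \<bullet> g)"
    using assms unfolding gderiv_def by (rule has_derivative_unique)
  then show "h = g"
    by (metis inner_commute vector_eq_rdot)
qed (fact assms)

definition laplacian :: "('a::euclidean_space \<Rightarrow> real) \<Rightarrow> 'a \<Rightarrow> real" where
  "laplacian f x =
     (\<Sum>i\<in>Basis. frechet_derivative (\<lambda>y. frechet_derivative f (at y) i) (at x) i)"

definition L_infinity :: "('a::euclidean_space \<Rightarrow> 'b::euclidean_space) \<Rightarrow> bool" where
  "L_infinity f \<longleftrightarrow>
     f \<in> borel_measurable lebesgue \<and> (\<exists>C. AE x in lebesgue. norm (f x) \<le> C)"

definition EP_lhs ::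
  "real \<Rightarrow> ('a::euclidean_space \<Rightarrow> 'a) \<Rightarrow> ('a \<Rightarrow> real) \<Rightarrow> real \<Rightarrow> real \<Rightarrow> ('a \<Rightarrow> real) \<Rightarrow> 'a \<Rightarrow> real" where
  "EP_lhs m b V \<beta> lam \<phi> x =
     lam - laplacian \<phi> x + b x \<bullet> gradient \<phi> x + norm (gradient \<phi> x) powr m / m - \<beta> * V x"

definition EP_subsolution ::
  "real \<Rightarrow> ('a::euclidean_space \<Rightarrow> 'a) \<Rightarrow> ('a \<Rightarrow> real) \<Rightarrow> real \<Rightarrow> real \<Rightarrow> ('a \<Rightarrow> real) \<Rightarrow> bool" where
  "EP_subsolution m b V \<beta> lam \<phi> \<longleftrightarrow> Ck 3 \<phi> \<and> (\<forall>x. EP_lhs m b V \<beta> lam \<phi> x \<le> 0)"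

text \<open>The supremum is taken in the extended reals, so that no boundedness has to be known
  beforehand; the real-valued \<open>Sup\<close> would be unspecified on unbounded sets.\<close>

definition lambda_max ::
  "real \<Rightarrow> ('a::euclidean_space \<Rightarrow> 'a) \<Rightarrow> ('a \<Rightarrow> real) \<Rightarrow> real \<Rightarrow> ereal" where
  "lambda_max m b V \<beta> = Sup {ereal lam | lam. \<exists>\<phi>. EP_subsolution m b V \<beta> lam \<phi>}"

definition lambda_bar ::
  "real \<Rightarrow> ('a::euclidean_space \<Rightarrow> 'a) \<Rightarrow> ('a \<Rightarrow> real) \<Rightarrow> ereal" where
  "lambda_bar m b V = Lim at_top (lambda_max m b V)"

definition conj_exponent :: "real \<Rightarrow> real" where
  "conj_exponent m = m / (m - 1)"

text \<open>The structural assumptions on \<open>(b, V)\<close> with constants \<open>\<rho>\<close>, \<open>R\<close>, \<open>a\<close>, \<open>\<eta>\<close>.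
  Positivity of \<open>\<rho>\<close>, \<open>R\<close>, \<open>\<eta>\<close> is not part of the predicate.\<close>

definition structural_assms ::
  "real \<Rightarrow> real \<Rightarrow> real \<Rightarrow> real \<Rightarrow> ('a::euclidean_space \<Rightarrow> 'a) \<Rightarrow> ('a \<Rightarrow> real) \<Rightarrow> bool" where
  "structural_assms \<rho> R a \<eta> b V \<longleftrightarrow>
     Ck 2 b \<and> Ck 2 V \<and> L_infinity (gradient V) \<and>
     (\<forall>x. x \<notin> ball 0 R \<longrightarrow> b x = ((\<rho> + a * inverse (norm x)) * inverse (norm x)) *\<^sub>R x) \<and>
     (\<forall>x. V x \<ge> 0) \<and>
     (\<forall>x \<in> closure (ball 0 R). V x > 0) \<and>
     (\<forall>x. x \<notin> ball 0 R \<longrightarrow> V x = norm x powr (- \<eta>))"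

end

theory Submission
  imports Defs
begin

text \<open>
  Let \<open>p = \<rho>\<^bsup>1/(m-1)\<^esup>\<close> and \<open>\<Lambda> = \<rho>\<^bsup>m*\<^esup> / m*\<close>. The gap \<open>F q = \<Lambda> + \<rho> q + \<bar>q\<bar>\<^sup>m / m\<close> in Young's inequality is
  nonnegative and vanishes only at \<open>q = - p\<close>. Outside \<open>B\<^sub>R\<close>, the left-hand side of the equation for
  \<open>\<phi> x = g (norm x)\<close> at distance \<open>r\<close> from the origin is, with \<open>q = g' r\<close> and \<open>\<alpha> = a - (d - 1)\<close>,
  \<open>(\<lambda> - \<Lambda>) + F q - q' + \<alpha> q / r - \<beta> r\<^bsup>-\<eta>\<^esup>\<close>.
  Everything is decided by this expression for large \<open>r\<close>.

  Upper bounds come from the maximum principle and never look at the ball \<open>B\<^sub>R\<close>. On a distant annulus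
  \<open>s < r < 3 s\<close> there is a radial barrier \<open>g\<close> that blows up at both boundary spheres and satisfies
  \<open>g'' < F g' / 2 + \<kappa> / (3 s)\<close> (\<open>annulus_barrier\<close>). For a subsolution \<open>\<phi>\<close>, the function \<open>\<phi> - g\<close> attains
  its maximum inside the annulus; there \<open>\<phi>\<close> and \<open>g\<close> have the same gradient and \<open>\<Delta>\<phi> \<le> \<Delta>g\<close>
  (\<open>touching_radial\<close>). If the remaining terms supply a forcing of at least \<open>2 \<kappa> / r\<close>, this contradicts
  the subsolution property, even with a small uniform margin in \<open>\<lambda>\<close> (\<open>no_subsolution_near\<close>). Such a
  forcing is available in two situations. If \<open>\<lambda> > \<Lambda>\<close>, the constant \<open>\<lambda> - \<Lambda>\<close> provides it; hence
  \<open>\<lambda>\<^sub>m\<^sub>a\<^sub>x \<le> \<Lambda>\<close> always. If \<open>\<alpha> < 0\<close> and \<open>\<eta> > 1\<close>, then already at \<open>\<lambda> = \<Lambda>\<close> the term \<open>\<alpha> q / r \<approx> \<bar>\<alpha>\<bar> p / r\<close>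
  provides it and dominates \<open>\<beta> r\<^bsup>-\<eta>\<^esup>\<close>; the margin gives \<open>\<lambda>\<^sub>m\<^sub>a\<^sub>x < \<Lambda>\<close>.

  Lower bounds come from one explicit function, equal to \<open>- p norm x\<close> outside the unit ball, for which
  the expression above is \<open>(\<lambda> - \<Lambda>) - \<alpha> p / r - \<beta> r\<^bsup>-\<eta>\<^esup>\<close>. It is nonpositive for large \<open>r\<close> if \<open>\<lambda> < \<Lambda>\<close>; for
  \<open>\<lambda> = \<Lambda>\<close> it is nonpositive if \<open>\<alpha> \<ge> 0\<close>, or if \<open>\<eta> \<le> 1\<close> and \<open>\<beta> \<ge> \<bar>\<alpha>\<bar> p\<close>. On the bounded remainder
  \<open>V\<close> is bounded away from zero and a large \<open>\<beta>\<close> wins (\<open>subsolution_exists\<close>). So \<open>\<lambda>\<^sub>m\<^sub>a\<^sub>x\<close> tends to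
  \<open>\<Lambda>\<close>, and reaches it for finite \<open>\<beta>\<close> in the last two cases.
\<close>

section \<open>Calculus of the class \<open>Ck\<close>\<close>

lemma Ck_Suc_has_derivative:
  assumes "Ck (Suc k) f"
  shows "(f has_derivative frechet_derivative f (at x)) (at x)"
  using assms frechet_derivative_works[of f "at x"] by simp

text \<open>
  The recursive clause of \<open>Ck\<close> speaks of \<^const>\<open>frechet_derivative\<close>; a closed form
  \<open>f'\<close> of the directional derivatives, together with uniqueness of derivatives, replaces it.
\<close>

lemma Ck_SucI:
  assumes der: "\<And>x. (f has_derivative (\<lambda>v. f' v x)) (at x)" and Ck: "\<And>v. Ck k (f' v)"
  shows "Ck (Suc k) f"
proof -
  have "(\<lambda>x. frechet_derivative f (at x) v) = f' v" for v
    by (rule ext) (simp add: frechet_derivative_at[OF der, symmetric])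
  moreover have "f differentiable (at x)" for x
    using der[of x] by (rule differentiableI)
  ultimately show ?thesis
    using Ck by simp
qed

lemma Ck_continuous: "Ck k f \<Longrightarrow> continuous_on UNIV f"
proof (cases k)
  case (Suc n)
  assume "Ck k f"
  then have "f differentiable_on UNIV"
    by (simp add: Suc differentiable_on_def)
  then show ?thesis
    by (rule differentiable_imp_continuous_on)
qed simp

lemma gradient_eq:
  assumes "Ck (Suc k) f" and "\<And>v. frechet_derivative f (at x) v = v \<bullet> g"
  shows "gradient f x = g"
proof -
  have "frechet_derivative f (at x) = (\<lambda>v. v \<bullet> g)"
    using assms(2) by blast
  then show ?thesis
    using Ck_Suc_has_derivative[OF assms(1), of x]
    by (intro gradient_eqI) (simp add: gderiv_def)
qed

text \<open>
  The coordinates of the gradient are directional derivatives, so its continuity can be read off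
  from the definition of \<open>Ck\<close>.
\<close>

lemma gradient_eq_sum:
  fixes f :: "'a::euclidean_space \<Rightarrow> real"
  assumes "Ck (Suc k) f"
  shows "gradient f x = (\<Sum>i\<in>Basis. frechet_derivative f (at x) i *\<^sub>R i)"
proof (rule gradient_eq[OF assms])
  fix v :: 'a
  interpret linear "frechet_derivative f (at x)"
    using Ck_Suc_has_derivative[OF assms] has_derivative_linear by blast
  have "frechet_derivative f (at x) v = frechet_derivative f (at x) (\<Sum>i\<in>Basis. (v \<bullet> i) *\<^sub>R i)"
    by (simp add: euclidean_representation)
  also have "\<dots> = (\<Sum>i\<in>Basis. (v \<bullet> i) * frechet_derivative f (at x) i)"
    by (simp add: sum scale)
  finally show "frechet_derivative f (at x) v =
      v \<bullet> (\<Sum>i\<in>Basis. frechet_derivative f (at x) i *\<^sub>R i)"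
    by (simp add: inner_sum_right mult.commute)
qed

lemma continuous_gradient:
  assumes "Ck (Suc k) f"
  shows "continuous_on UNIV (gradient f)"
  unfolding gradient_eq_sum[OF assms, abs_def]
  using assms by (intro continuous_on_sum continuous_on_scaleR continuous_on_const
      Ck_continuous[of k]) simp

lemma continuous_laplacian:
  assumes "Ck (Suc (Suc k)) f"
  shows "continuous_on UNIV (laplacian f)"
  unfolding laplacian_def[abs_def]
  using assms by (intro continuous_on_sum Ck_continuous[of k]) simp

section \<open>The gap in Young's inequality\<close>

text \<open>
  The maximum over \<open>q\<close> of \<open>- \<rho> q - \<bar>q\<bar>\<^sup>m / m\<close>, that is, the Legendre transform of
  \<open>\<bar>q\<bar>\<^sup>m / m\<close> at \<open>\<rho>\<close>.
\<close>

definition lam_crit :: "real \<Rightarrow> real \<Rightarrow> real" where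
  "lam_crit m \<rho> = \<rho> powr conj_exponent m / conj_exponent m"

text \<open>
  The maximum defining \<open>lam_crit\<close> is attained exactly at \<open>q = - crit_slope m \<rho>\<close>.
\<close>

definition crit_slope :: "real \<Rightarrow> real \<Rightarrow> real" where
  "crit_slope m \<rho> = \<rho> powr (1 / (m - 1))"

text \<open>
  The defect in Young's inequality \<open>- \<rho> q \<le> lam_crit m \<rho> + \<bar>q\<bar>\<^sup>m / m\<close>. For a radial function
  with slope \<open>q\<close> it is all that the drift \<open>\<rho>\<close> and the nonlinearity contribute to the equation, apart
  from the constant \<open>lam_crit\<close>.
\<close>

definition young_gap :: "real \<Rightarrow> real \<Rightarrow> real \<Rightarrow> real" where
  "young_gap m \<rho> q = lam_crit m \<rho> + \<rho> * q + \<bar>q\<bar> powr m / m"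

lemma crit_slope_pos: "\<rho> > 0 \<Longrightarrow> crit_slope m \<rho> > 0"
  by (simp add: crit_slope_def)

lemma crit_slope_powr:
  assumes "m > 1" "\<rho> > 0"
  shows "crit_slope m \<rho> powr (m - 1) = \<rho>"
  using assms by (simp add: crit_slope_def powr_powr)

lemma powr_eq_mult_powr_diff: "0 < (x::real) \<Longrightarrow> x powr m = x * x powr (m - 1)"
  by (simp add: powr_diff)

lemma lam_crit_eq:
  assumes "m > 1" "\<rho> > 0"
  shows "lam_crit m \<rho> = \<rho> * crit_slope m \<rho> - crit_slope m \<rho> powr m / m"
proof -
  define p where "p = crit_slope m \<rho>"
  have "\<rho> powr conj_exponent m = p powr m"
    by (simp add: p_def crit_slope_def conj_exponent_def powr_powr)
  moreover have "p powr m = \<rho> * p"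
    using powr_eq_mult_powr_diff[of p m] crit_slope_powr[OF assms] crit_slope_pos[OF assms(2)]
    by (simp add: p_def)
  ultimately show ?thesis
    using assms(1) by (simp add: lam_crit_def conj_exponent_def field_simps flip: p_def)
qed

lemma lam_crit_pos: "m > 1 \<Longrightarrow> \<rho> > 0 \<Longrightarrow> lam_crit m \<rho> > 0"
  by (simp add: lam_crit_def conj_exponent_def)

lemma young_gap_crit_slope:
  assumes "m > 1" "\<rho> > 0"
  shows "young_gap m \<rho> (- crit_slope m \<rho>) = 0"
  using lam_crit_eq[OF assms] crit_slope_pos[OF assms(2), of m] by (simp add: young_gap_def)

text \<open>
  For \<open>q < 0\<close>, write \<open>t = - q\<close>: the derivative \<open>t\<^bsup>m-1\<^esup> - \<rho>\<close> of \<open>t\<^sup>m / m - \<rho> t\<close> changes sign from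
  negative to positive at \<open>crit_slope\<close>, which is therefore the only minimiser. For \<open>q \<ge> 0\<close> every
  term is nonnegative and the constant one is positive.
\<close>

lemma young_gap_pos:
  assumes m: "m > 1" and \<rho>: "\<rho> > 0" and q: "q \<noteq> - crit_slope m \<rho>"
  shows "young_gap m \<rho> q > 0"
proof (cases "q \<ge> 0")
  case True
  then show ?thesis
    using lam_crit_pos[OF m \<rho>] m \<rho> unfolding young_gap_def
    by (intro add_pos_nonneg) auto
next
  case False
  define p t where "p = crit_slope m \<rho>" and "t = - q"
  have p: "p > 0" "p powr (m - 1) = \<rho>" and t: "t > 0" "t \<noteq> p"
    using crit_slope_pos[OF \<rho>] crit_slope_powr[OF m \<rho>] False q by (auto simp: p_def t_def)
  define f where "f = (\<lambda>s. s powr m / m - \<rho> * s)"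
  have der: "(f has_real_derivative s powr (m - 1) - \<rho>) (at s)" if "s > 0" for s
    unfolding f_def using that m by (auto intro!: derivative_eq_intros)
  have cont: "continuous_on {x..y} f" if "x > 0" for x y
  proof (rule DERIV_continuous_on)
    fix s assume "s \<in> {x..y}"
    then show "(f has_real_derivative s powr (m - 1) - \<rho>) (at s within {x..y})"
      using that by (intro has_field_derivative_at_within[OF der]) simp
  qed
  have "f p < f t"
  proof (cases "t < p")
    case True
    show ?thesis
    proof (rule DERIV_neg_imp_decreasing_open[OF True])
      fix s assume s: "t < s" "s < p"
      then have "s powr (m - 1) < p powr (m - 1)"
        using t m by (intro powr_less_mono2) auto
      then show "\<exists>y. (f has_real_derivative y) (at s) \<and> y < 0"
        using der[of s] s t p by (intro exI[of _ "s powr (m - 1) - \<rho>"]) auto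
    qed (use cont t in auto)
  next
    case False
    then have "p < t" using t by simp
    then show ?thesis
    proof (rule DERIV_pos_imp_increasing_open)
      fix s assume s: "p < s" "s < t"
      then have "p powr (m - 1) < s powr (m - 1)"
        using p m by (intro powr_less_mono2) auto
      then show "\<exists>y. (f has_real_derivative y) (at s) \<and> 0 < y"
        using der[of s] s p by (intro exI[of _ "s powr (m - 1) - \<rho>"]) auto
    qed (use cont p in auto)
  qed
  then show ?thesis
    using lam_crit_eq[OF m \<rho>] t by (simp add: young_gap_def f_def p_def t_def)
qed

lemma young_gap_nonneg: "m > 1 \<Longrightarrow> \<rho> > 0 \<Longrightarrow> young_gap m \<rho> q \<ge> 0"
  using young_gap_pos[of m \<rho> q] young_gap_crit_slope[of m \<rho>] by fastforce

text \<open>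
  The power \<open>m\<close> is right at infinity, where \<open>\<bar>q\<bar>\<^sup>m / m\<close> beats the linear term, and on a bounded
  set away from \<open>- crit_slope\<close> the quotient of both sides is continuous and positive. No such bound
  holds near \<open>- crit_slope\<close> when \<open>m < 2\<close>, where the gap is only quadratic; hence the threshold \<open>A\<close>.
\<close>

lemma young_gap_coercive:
  assumes m: "m > 1" and \<rho>: "\<rho> > 0" and A: "A > 0"
  obtains c where "c > 0"
    and "\<And>q. A \<le> \<bar>q + crit_slope m \<rho>\<bar> \<Longrightarrow> c * \<bar>q + crit_slope m \<rho>\<bar> powr m \<le> young_gap m \<rho> q"
proof -
  define p where "p = crit_slope m \<rho>"
  have p: "p > 0" using crit_slope_pos[OF \<rho>] by (simp add: p_def)
  \<comment> \<open>Beyond \<open>Q\<close> the nonlinearity is at least twice the linear term, and \<open>\<bar>q + p\<bar> \<le> 2 \<bar>q\<bar>\<close>.\<close>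
  define Q where "Q = max p ((2 * m * \<rho>) powr (1 / (m - 1)))"
  define c1 where "c1 = 1 / (2 * m * 2 powr m)"
  have large: "c1 * \<bar>q + p\<bar> powr m \<le> young_gap m \<rho> q" if "Q \<le> \<bar>q\<bar>" for q
  proof -
    have q: "p \<le> \<bar>q\<bar>" "(2 * m * \<rho>) powr (1 / (m - 1)) \<le> \<bar>q\<bar>"
      using that by (auto simp: Q_def)
    have "2 * m * \<rho> = ((2 * m * \<rho>) powr (1 / (m - 1))) powr (m - 1)"
      using m \<rho> by (simp add: powr_powr)
    also have "\<dots> \<le> \<bar>q\<bar> powr (m - 1)"
      using q m by (intro powr_mono2) auto
    finally have "\<bar>q\<bar> * (2 * m * \<rho>) \<le> \<bar>q\<bar> powr m"
      using powr_eq_mult_powr_diff[of "\<bar>q\<bar>" m] p q by (metis abs_ge_zero less_le_trans mult_left_mono)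
    then have "\<rho> * \<bar>q\<bar> \<le> \<bar>q\<bar> powr m / (2 * m)"
      using m by (simp add: field_simps)
    moreover have "- (\<rho> * \<bar>q\<bar>) \<le> \<rho> * q"
      using \<rho> by (simp add: abs_if)
    moreover have "\<bar>q\<bar> powr m / m = \<bar>q\<bar> powr m / (2 * m) + \<bar>q\<bar> powr m / (2 * m)"
      using m by (simp add: field_simps)
    ultimately have "\<bar>q\<bar> powr m / (2 * m) \<le> young_gap m \<rho> q"
      using lam_crit_pos[OF m \<rho>] unfolding young_gap_def by linarith
    moreover have "\<bar>q + p\<bar> powr m \<le> (2 * \<bar>q\<bar>) powr m"
      using q p m by (intro powr_mono2) auto
    then have "c1 * \<bar>q + p\<bar> powr m \<le> \<bar>q\<bar> powr m / (2 * m)"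
      using m by (simp add: c1_def powr_mult field_simps)
    ultimately show ?thesis by linarith
  qed
  define K where "K = {q. \<bar>q\<bar> \<le> Q \<and> A \<le> \<bar>q + p\<bar>}"
  have cK: "compact K"
  proof (rule compact_eq_bounded_closed[THEN iffD2], intro conjI)
    show "bounded K" by (rule boundedI[of _ Q]) (simp add: K_def)
    show "closed K" unfolding K_def by (intro closed_Collect_conj closed_Collect_le continuous_intros)
  qed
  have "\<exists>c>0. \<forall>q\<in>K. c * \<bar>q + p\<bar> powr m \<le> young_gap m \<rho> q"
  proof (cases "K = {}")
    case False
    have "continuous_on K (\<lambda>q. young_gap m \<rho> q / \<bar>q + p\<bar> powr m)"
      unfolding young_gap_def using m A
      by (intro continuous_intros continuous_on_powr') (auto simp: K_def)
    from continuous_attains_inf[OF cK False this] obtain q0 where q0: "q0 \<in> K"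
      "\<And>q. q \<in> K \<Longrightarrow> young_gap m \<rho> q0 / \<bar>q0 + p\<bar> powr m \<le> young_gap m \<rho> q / \<bar>q + p\<bar> powr m"
      by blast
    have "young_gap m \<rho> q0 > 0"
      using q0(1) A by (intro young_gap_pos[OF m \<rho>]) (auto simp: K_def p_def)
    moreover have "\<bar>q + p\<bar> powr m > 0" if "q \<in> K" for q
      using that A by (auto simp: K_def)
    ultimately have "young_gap m \<rho> q0 / \<bar>q0 + p\<bar> powr m > 0"
      and "young_gap m \<rho> q0 / \<bar>q0 + p\<bar> powr m * \<bar>q + p\<bar> powr m \<le> young_gap m \<rho> q"
      if "q \<in> K" for q
      using q0 that pos_le_divide_eq by (blast intro: divide_pos_pos)+
    then show ?thesis
      using q0(1) by blast
  qed (auto intro: exI[of _ 1])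
  then obtain c2 where c2: "c2 > 0" "\<And>q. q \<in> K \<Longrightarrow> c2 * \<bar>q + p\<bar> powr m \<le> young_gap m \<rho> q"
    by blast
  show ?thesis
  proof (rule that[of "min c1 c2"])
    show "min c1 c2 > 0" using c2(1) m by (simp add: c1_def)
    fix q assume "A \<le> \<bar>q + crit_slope m \<rho>\<bar>"
    then have "q \<in> K \<or> Q \<le> \<bar>q\<bar>" by (auto simp: K_def p_def)
    moreover have "min c1 c2 * \<bar>q + p\<bar> powr m \<le> c * \<bar>q + p\<bar> powr m" if "c = c1 \<or> c = c2" for c
      using that by (intro mult_right_mono) auto
    ultimately show "min c1 c2 * \<bar>q + crit_slope m \<rho>\<bar> powr m \<le> young_gap m \<rho> q"
      unfolding p_def[symmetric] using c2(2)[of q] large[of q] order_trans by blast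
  qed
qed

section \<open>Touching by radial functions\<close>

lemma second_derivative_test_max:
  fixes h h1 :: "real \<Rightarrow> real"
  assumes e: "0 < e" and h: "\<And>t. \<bar>t\<bar> < e \<Longrightarrow> (h has_real_derivative h1 t) (at t)"
    and h1: "(h1 has_real_derivative h2) (at 0)" and max: "\<And>t. \<bar>t\<bar> < e \<Longrightarrow> h t \<le> h 0"
  shows "h1 0 = 0" and "h2 \<le> 0"
proof -
  show h10: "h1 0 = 0"
    using DERIV_local_max[OF h[of 0] e] e max by simp
  show "h2 \<le> 0"
  proof (rule ccontr)
    assume "\<not> h2 \<le> 0"
    then obtain d where d: "d > 0" "\<And>t. 0 < t \<Longrightarrow> t < d \<Longrightarrow> 0 < h1 t"
      using DERIV_pos_inc_right[OF h1] h10 by auto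
    define s where "s = min d e / 2"
    have s: "0 < s" "s < d" "s < e"
      using d(1) e by (auto simp: s_def)
    have "h 0 < h s"
    proof (rule DERIV_pos_imp_increasing_open[OF s(1)])
      fix t assume "0 < t" "t < s"
      then show "\<exists>y. (h has_real_derivative y) (at t) \<and> 0 < y"
        using h[of t] d(2)[of t] s by auto
    next
      show "continuous_on {0..s} h"
      proof (rule DERIV_continuous_on)
        fix t assume "t \<in> {0..s}"
        then show "(h has_real_derivative h1 t) (at t within {0..s})"
          using s by (intro has_field_derivative_at_within[OF h]) simp
      qed
    qed
    then show False using max[of s] s by simp
  qed
qed

text \<open>
  Along the line \<open>t \<mapsto> x + t v\<close> the difference \<open>\<phi> - g (norm \<cdot>)\<close> has a maximum at \<open>t = 0\<close>. The first
  derivative test in all directions gives the gradient. Summing the second derivative test over an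
  orthonormal basis gives the Laplacian, since the second derivatives of the norm along \<open>v\<close>, namely
  \<open>(v \<bullet> v) / r - (v \<bullet> x)\<^sup>2 / r\<^sup>3\<close>, add up to \<open>(d - 1) / r\<close>.
\<close>

lemma touching_radial:
  fixes \<phi> :: "'a::euclidean_space \<Rightarrow> real" and x :: 'a
  assumes Ck: "Ck (Suc (Suc k)) \<phi>" and x: "r0 < norm x" "norm x < r1" and r0: "0 \<le> r0"
    and g: "\<And>r. r0 < r \<Longrightarrow> r < r1 \<Longrightarrow> (g has_real_derivative g1 r) (at r)"
    and g1: "(g1 has_real_derivative g2) (at (norm x))"
    and max: "\<And>y. r0 < norm y \<Longrightarrow> norm y < r1 \<Longrightarrow> \<phi> y - g (norm y) \<le> \<phi> x - g (norm x)"
  shows "gradient \<phi> x = (g1 (norm x) / norm x) *\<^sub>R x"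
    and "laplacian \<phi> x \<le> g2 + (real DIM('a) - 1) * (g1 (norm x) / norm x)"
proof -
  define r where "r = norm x"
  have r: "r > 0" "r0 < r" "r < r1" using x r0 by (auto simp: r_def)
  have key: "frechet_derivative \<phi> (at x) v = v \<bullet> ((g1 r / r) *\<^sub>R x) \<and>
      frechet_derivative (\<lambda>y. frechet_derivative \<phi> (at y) v) (at x) v \<le>
        g2 * (v \<bullet> x)\<^sup>2 / r\<^sup>2 + g1 r * (v \<bullet> v / r - (v \<bullet> x)\<^sup>2 / r ^ 3)" for v
  proof -
    define e where "e = min (r - r0) (r1 - r) / (norm v + 1)"
    have e: "e > 0" using r by (simp add: e_def add_nonneg_pos)
    have near: "r0 < norm (x + t *\<^sub>R v) \<and> norm (x + t *\<^sub>R v) < r1" if "\<bar>t\<bar> < e" for t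
    proof -
      have "\<bar>norm (x + t *\<^sub>R v) - r\<bar> \<le> \<bar>t\<bar> * norm v"
        using norm_triangle_ineq3[of "x + t *\<^sub>R v" x] by (simp add: r_def)
      also have "\<dots> \<le> \<bar>t\<bar> * (norm v + 1)"
        by (intro mult_left_mono) auto
      also have "\<dots> < e * (norm v + 1)"
        using that by (intro mult_strict_right_mono) (auto simp: add_nonneg_pos)
      also have "\<dots> = min (r - r0) (r1 - r)"
        unfolding e_def using norm_ge_zero[of v] by (simp add: add_nonneg_eq_0_iff)
      finally show ?thesis by auto
    qed
    have line: "((\<lambda>t. x + t *\<^sub>R v) has_derivative (\<lambda>t. t *\<^sub>R v)) (at t)" for t
      by (auto intro!: derivative_eq_intros)
    \<comment> \<open>The chain rule along the line; it serves both for \<open>\<phi>\<close> and for its directional derivatives.\<close>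
    have along: "((\<lambda>t. f (x + t *\<^sub>R v)) has_real_derivative frechet_derivative f (at (x + t *\<^sub>R v)) v) (at t)"
      if "Ck (Suc j) f" for f :: "'a \<Rightarrow> real" and j t
    proof -
      have D: "(f has_derivative frechet_derivative f (at y)) (at y)" for y
        using Ck_Suc_has_derivative[OF that] .
      have "linear (frechet_derivative f (at y))" for y
        using D has_derivative_linear by blast
      then have "(\<lambda>s. frechet_derivative f (at y) (s *\<^sub>R v)) = (*) (frechet_derivative f (at y) v)" for y
        by (auto simp: linear_scale mult.commute)
      then show ?thesis
        using has_derivative_compose[OF line D] by (simp add: has_field_derivative_def)
    qed
    have norm_line: "((\<lambda>t. norm (x + t *\<^sub>R v)) has_real_derivative
        (v \<bullet> (x + t *\<^sub>R v)) / norm (x + t *\<^sub>R v)) (at t)" if "x + t *\<^sub>R v \<noteq> 0" for t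
      using has_derivative_compose[OF line has_derivative_norm[OF that]]
      unfolding has_field_derivative_def
      by (rule has_derivative_eq_rhs) (auto simp: sgn_div_norm divide_inverse mult_ac)
    define h where "h = (\<lambda>t. \<phi> (x + t *\<^sub>R v) - g (norm (x + t *\<^sub>R v)))"
    define h1 where "h1 = (\<lambda>t. frechet_derivative \<phi> (at (x + t *\<^sub>R v)) v
        - g1 (norm (x + t *\<^sub>R v)) * ((v \<bullet> (x + t *\<^sub>R v)) / norm (x + t *\<^sub>R v)))"
    have dh: "(h has_real_derivative h1 t) (at t)" if "\<bar>t\<bar> < e" for t
    proof -
      have "x + t *\<^sub>R v \<noteq> 0" using near[OF that] r0 by auto
      then show ?thesis
        unfolding h_def h1_def using near[OF that]
        by (intro DERIV_diff along[OF Ck] DERIV_chain2[OF g norm_line]) auto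
    qed
    have x0: "x \<noteq> 0" using r by (auto simp: r_def)
    have in_line: "((\<lambda>t. v \<bullet> (x + t *\<^sub>R v)) has_real_derivative v \<bullet> v) (at 0)"
      by (auto intro!: derivative_eq_intros simp: inner_add_right)
    have nl: "((\<lambda>t. norm (x + t *\<^sub>R v)) has_real_derivative (v \<bullet> x) / r) (at 0)"
      using norm_line[of 0] x0 by (simp add: r_def)
    have g1r: "((\<lambda>t. g1 (norm (x + t *\<^sub>R v))) has_real_derivative g2 * ((v \<bullet> x) / r)) (at 0)"
      using nl g1 by (intro DERIV_chain2[of g1]) auto
    have Ck1: "Ck (Suc k) (\<lambda>y. frechet_derivative \<phi> (at y) v)"
      using Ck Ck.simps(2)[of "Suc k" \<phi>] by blast
    have cos_line: "((\<lambda>t. (v \<bullet> (x + t *\<^sub>R v)) / norm (x + t *\<^sub>R v)) has_real_derivative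
        v \<bullet> v / r - (v \<bullet> x)\<^sup>2 / r ^ 3) (at 0)"
      by (rule DERIV_cong[OF DERIV_divide[OF in_line nl]])
        (use x0 r in \<open>simp_all add: r_def[symmetric] field_simps power2_eq_square power3_eq_cube\<close>)
    have "(h1 has_real_derivative frechet_derivative (\<lambda>y. frechet_derivative \<phi> (at y) v) (at x) v
       - (g2 * (v \<bullet> x)\<^sup>2 / r\<^sup>2 + g1 r * (v \<bullet> v / r - (v \<bullet> x)\<^sup>2 / r ^ 3))) (at 0)"
      unfolding h1_def
      by (rule DERIV_cong[OF DERIV_diff[OF along[OF Ck1, of 0] DERIV_mult[OF g1r cos_line]]])
        (use r in \<open>simp add: r_def[symmetric] power2_eq_square\<close>)
    from second_derivative_test_max[OF e dh this] have
      "h1 0 = 0 \<and> frechet_derivative (\<lambda>y. frechet_derivative \<phi> (at y) v) (at x) v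
       - (g2 * (v \<bullet> x)\<^sup>2 / r\<^sup>2 + g1 r * (v \<bullet> v / r - (v \<bullet> x)\<^sup>2 / r ^ 3)) \<le> 0"
      using max near by (simp add: h_def)
    then show ?thesis
      by (auto simp: h1_def r_def)
  qed
  show "gradient \<phi> x = (g1 (norm x) / norm x) *\<^sub>R x"
    by (rule gradient_eq[OF Ck]) (use key in \<open>simp add: r_def\<close>)
  have sq: "(\<Sum>i\<in>Basis. (i \<bullet> x)\<^sup>2) = r\<^sup>2"
    unfolding r_def power2_norm_eq_inner
    by (subst euclidean_inner) (simp add: inner_commute power2_eq_square)
  have "laplacian \<phi> x \<le> (\<Sum>i\<in>Basis. g2 * (i \<bullet> x)\<^sup>2 / r\<^sup>2 + g1 r * (1 / r - (i \<bullet> x)\<^sup>2 / r ^ 3))"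
    unfolding laplacian_def using key by (intro sum_mono) (auto simp flip: inner_same_Basis)
  also have "\<dots> = g2 * r\<^sup>2 / r\<^sup>2 + g1 r * (real DIM('a) * (1 / r) - r\<^sup>2 / r ^ 3)"
    by (simp add: sum.distrib sum_subtractf flip: sum_distrib_left sum_divide_distrib sq)
  also have "\<dots> = g2 + (real DIM('a) - 1) * (g1 r / r)"
    using r by (simp add: field_simps power2_eq_square power3_eq_cube)
  finally show "laplacian \<phi> x \<le> g2 + (real DIM('a) - 1) * (g1 (norm x) / norm x)"
    by (simp add: r_def)
qed

text \<open>
  A barrier that blows up on both boundary spheres confines the maximum of \<open>\<phi> - g\<close> to a compact
  part of the open annulus. This uses \<open>\<phi>\<close> on a bounded set only, so neither its growth at infinity
  nor the coefficients near the origin matter.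
\<close>

lemma annulus_touching_point:
  fixes \<phi> :: "'a::euclidean_space \<Rightarrow> real" and g :: "real \<Rightarrow> real"
  assumes \<phi>: "continuous_on UNIV \<phi>" and g: "continuous_on {r0<..<r1} g"
    and r: "0 \<le> r0" "r0 < r1"
    and lim0: "filterlim g at_top (at_right r0)" and lim1: "filterlim g at_top (at_left r1)"
  obtains x where "r0 < norm x" "norm x < r1"
    "\<And>y. r0 < norm y \<Longrightarrow> norm y < r1 \<Longrightarrow> \<phi> y - g (norm y) \<le> \<phi> x - g (norm x)"
proof -
  define mid where "mid = (r0 + r1) / 2"
  have mid: "r0 < mid" "mid < r1" using r by (auto simp: mid_def)
  obtain x0 :: 'a where x0: "norm x0 = mid"
    using vector_choose_size[of mid] mid r by auto
  have "\<exists>x\<in>cball 0 r1. \<forall>y\<in>cball 0 r1. \<phi> y \<le> \<phi> x"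
    using r by (intro continuous_attains_sup continuous_on_subset[OF \<phi>]) auto
  then obtain xM where "\<forall>y\<in>cball 0 r1. \<phi> y \<le> \<phi> xM"
    by blast
  then have xM: "\<phi> y \<le> \<phi> xM" if "norm y \<le> r1" for y
    using that by simp
  define B where "B = \<phi> xM - (\<phi> x0 - g mid)"
  have "eventually (\<lambda>r. B \<le> g r) (at_right r0)" "eventually (\<lambda>r. B \<le> g r) (at_left r1)"
    using lim0 lim1 by (auto simp: filterlim_at_top)
  then obtain b0 b1 where b: "b0 > r0" "\<And>r. r0 < r \<Longrightarrow> r < b0 \<Longrightarrow> B \<le> g r"
      "b1 < r1" "\<And>r. b1 < r \<Longrightarrow> r < r1 \<Longrightarrow> B \<le> g r"
    by (auto simp: eventually_at_right_field eventually_at_left_field)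
  define K where "K = {y :: 'a. min b0 mid \<le> norm y \<and> norm y \<le> max b1 mid}"
  have K: "r0 < norm y \<and> norm y < r1" if "y \<in> K" for y
    using that b mid by (auto simp: K_def)
  have "compact K"
  proof (rule compact_eq_bounded_closed[THEN iffD2], intro conjI)
    show "bounded K" by (rule boundedI[of _ "max b1 mid"]) (simp add: K_def)
    show "closed K" unfolding K_def by (intro closed_Collect_conj closed_Collect_le continuous_intros)
  qed
  moreover have "x0 \<in> K" using x0 by (simp add: K_def)
  moreover have "continuous_on K (\<lambda>y. \<phi> y - g (norm y))"
    using K by (intro continuous_intros continuous_on_subset[OF \<phi>] continuous_on_compose2[OF g]) auto
  ultimately obtain x where x: "x \<in> K" "\<And>y. y \<in> K \<Longrightarrow> \<phi> y - g (norm y) \<le> \<phi> x - g (norm x)"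
    using continuous_attains_sup[of K "\<lambda>y. \<phi> y - g (norm y)"] by blast
  show ?thesis
  proof (rule that[of x])
    fix y :: 'a assume y: "r0 < norm y" "norm y < r1"
    show "\<phi> y - g (norm y) \<le> \<phi> x - g (norm x)"
    proof (cases "y \<in> K")
      case False
      then have "B \<le> g (norm y)"
        using b(2)[of "norm y"] b(4)[of "norm y"] y by (auto simp: K_def)
      then have "\<phi> y - g (norm y) \<le> \<phi> x0 - g (norm x0)"
        using xM[of y] y by (simp add: B_def x0)
      also have "\<dots> \<le> \<phi> x - g (norm x)"
        using x(2) \<open>x0 \<in> K\<close> .
      finally show ?thesis .
    qed (use x in auto)
  qed (use K x in auto)
qed

section \<open>A radial barrier on large annuli\<close>

text \<open>
  With \<open>w = g' + p\<close>, \<open>p = crit_slope m \<rho>\<close>, the inequality is of the type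
  \<open>w' < \<kappa> / (3 s) + c \<bar>w\<bar>\<^sup>m\<close>, whose solutions go from \<open>-\<infinity>\<close> to \<open>\<infinity>\<close> in a time that
  is short compared with \<open>s\<close> when \<open>s\<close> is large. In the variable \<open>y = (r - 2 s) / s\<close>, ranging over
  \<open>(-1, 1)\<close>, an explicit choice is \<open>w = A y (1 - y\<^sup>2)\<^bsup>-n-1\<^esup>\<close>, so that \<open>w'\<close> is of order
  \<open>(A / s) (1 - y\<^sup>2)\<^bsup>-n-2\<^esup>\<close>. For \<open>\<bar>y\<bar> \<le> 1/2\<close> the forcing \<open>\<kappa> / (3 s)\<close> absorbs this because both sides scale
  like \<open>1 / s\<close> and \<open>A\<close> is small relative to \<open>\<kappa>\<close>. For \<open>\<bar>y\<bar> \<ge> 1/2\<close> coercivity absorbs it because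
  \<open>(n + 1) m \<ge> n + 2\<close> and \<open>s\<close> is large. The primitive of \<open>w\<close> is a multiple of \<open>(1 - y\<^sup>2)\<^bsup>-n\<^esup>\<close>,
  which still blows up at both ends as \<open>n \<ge> 1\<close>.
\<close>

lemma annulus_barrier:
  assumes m: "m > 1" and \<rho>: "\<rho> > 0" and \<kappa>: "\<kappa> > 0"
  shows "\<forall>\<^sub>F s in at_top. \<exists>g g1 g2.
    (\<forall>r\<in>{s<..<3 * s}. (g has_real_derivative g1 r) (at r) \<and> (g1 has_real_derivative g2 r) (at r)
        \<and> g2 r < young_gap m \<rho> (g1 r) / 2 + \<kappa> / (3 * s))
    \<and> filterlim g at_top (at_right s) \<and> filterlim g at_top (at_left (3 * s))"
proof -
  define p where "p = crit_slope m \<rho>"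
  obtain n :: nat where n: "n > 0" "(real n + 1) * (m - 1) \<ge> 1"
  proof -
    obtain k where "1 / (m - 1) < real k" using reals_Archimedean2 by blast
    then have "(real (Suc k) + 1) * (m - 1) \<ge> 1"
      using m by (simp add: field_simps)
    then show ?thesis using that[of "Suc k"] by simp
  qed
  obtain k where k: "n = Suc k"
    using n(1) gr0_implies_Suc by blast
  \<comment> \<open>\<open>A\<close> is chosen so that \<open>w' \<le> \<kappa> / (4 s)\<close> on the middle half, where \<open>1 / (1 - y\<^sup>2) \<le> 2\<close>.\<close>
  define A where "A = \<kappa> / (4 * (2 * real n + 3) * 2 ^ (n + 2))"
  have A: "A > 0" using \<kappa> by (simp add: A_def)
  obtain c where c: "c > 0" and coercive:
    "\<And>q. A / 2 \<le> \<bar>q + p\<bar> \<Longrightarrow> c * \<bar>q + p\<bar> powr m \<le> young_gap m \<rho> q"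
    using young_gap_coercive[OF m \<rho>, of "A / 2"] A unfolding p_def by auto
  \<comment> \<open>From \<open>S\<close> on, half of the gap dominates \<open>w'\<close> on the outer parts of the annulus.\<close>
  define S where "S = A * (2 * real n + 3) / (c / 2 * (A / 2) powr m)"
  have large: "\<forall>\<^sub>F s in at_top. s > 0 \<and> s \<ge> S"
    by (intro eventually_conj eventually_gt_at_top eventually_ge_at_top)
  show ?thesis
  proof (rule eventually_mono[OF large])
    fix s assume s: "s > 0 \<and> s \<ge> S"
    define y where "y = (\<lambda>r. (r - 2 * s) / s)"
    define u where "u = (\<lambda>r. 1 - (y r)\<^sup>2)"
    define z where "z = (\<lambda>r. inverse (u r))"
    define g where "g = (\<lambda>r. - p * r + A * s / (2 * real n) * z r ^ n)"
    define g1 where "g1 = (\<lambda>r. - p + A * y r * z r ^ (n + 1))"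
    define g2 where "g2 = (\<lambda>r. A / s * (z r ^ (n + 1) + 2 * (real n + 1) * (y r)\<^sup>2 * z r ^ (n + 2)))"
    have y_bound: "\<bar>y r\<bar> < 1" if "r \<in> {s<..<3 * s}" for r
      using that s by (auto simp: y_def abs_less_iff field_simps)
    have u_pos: "u r > 0" if "r \<in> {s<..<3 * s}" for r
      using y_bound[OF that] by (simp add: u_def abs_square_less_1)
    have dy: "(y has_real_derivative 1 / s) (at r)" for r
      unfolding y_def using s by (auto intro!: derivative_eq_intros)
    have du: "(u has_real_derivative - 2 * y r / s) (at r)" for r
      unfolding u_def by (auto intro!: derivative_eq_intros dy)
    have dz: "(z has_real_derivative 2 * y r / s * (z r)\<^sup>2) (at r)" if "r \<in> {s<..<3 * s}" for r
      unfolding z_def using u_pos[OF that]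
      by (auto intro!: derivative_eq_intros du simp: power2_eq_square)
    have dg: "(g has_real_derivative g1 r) (at r)" if "r \<in> {s<..<3 * s}" for r
    proof -
      have "(g has_real_derivative - p + A * s / (2 * real n) *
          (real n * (2 * y r / s * (z r)\<^sup>2 * z r ^ (n - Suc 0)))) (at r)"
        unfolding g_def by (auto intro!: derivative_eq_intros dz that)
      moreover have "- p + A * s / (2 * real n) * (real n * (2 * y r / s * (z r)\<^sup>2 * z r ^ (n - Suc 0)))
          = g1 r"
        using s by (simp add: g1_def k power2_eq_square field_simps add_nonneg_eq_0_iff)
      ultimately show ?thesis by simp
    qed
    have dg1: "(g1 has_real_derivative g2 r) (at r)" if "r \<in> {s<..<3 * s}" for r
    proof -
      have "((\<lambda>r. z r ^ (n + 1)) has_real_derivative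
          real (n + 1) * (2 * y r / s * (z r)\<^sup>2 * z r ^ n)) (at r)"
        using DERIV_power[OF dz[OF that], of "n + 1"] by simp
      from DERIV_add[OF DERIV_const[of "- p"] DERIV_mult[OF DERIV_cmult[OF dy, of A] this]]
      show ?thesis
        unfolding g1_def by (rule DERIV_cong) (use s in \<open>simp add: g2_def field_simps power2_eq_square\<close>)
    qed
    have ineq: "g2 r < young_gap m \<rho> (g1 r) / 2 + \<kappa> / (3 * s)" if r: "r \<in> {s<..<3 * s}" for r
    proof -
      have z1: "z r \<ge> 1"
        unfolding z_def using u_pos[OF r] by (intro one_le_inverse) (auto simp: u_def)
      have "2 * (real n + 1) * (y r)\<^sup>2 * z r ^ (n + 2) \<le> 2 * (real n + 1) * 1 * z r ^ (n + 2)"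
        using y_bound[OF r] z1
        by (intro mult_right_mono mult_left_mono) (auto simp: abs_square_le_1)
      moreover have "z r ^ (n + 1) \<le> z r ^ (n + 2)"
        using z1 by (intro power_increasing) auto
      ultimately have "z r ^ (n + 1) + 2 * (real n + 1) * (y r)\<^sup>2 * z r ^ (n + 2)
          \<le> (2 * real n + 3) * z r ^ (n + 2)"
        by (simp add: algebra_simps)
      then have g2_le: "g2 r \<le> A / s * ((2 * real n + 3) * z r ^ (n + 2))"
        unfolding g2_def using A s by (intro mult_left_mono) auto
      show ?thesis
      proof (cases "\<bar>y r\<bar> \<le> 1 / 2")
        case True
        then have "(y r)\<^sup>2 \<le> (1 / 2)\<^sup>2" by (metis abs_le_square_iff abs_of_nonneg zero_le_divide_1_iff zero_le_numeral)
        then have "u r \<ge> 1 / 2" by (simp add: u_def power2_eq_square)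
        then have "z r \<le> 2" using le_imp_inverse_le[of "1/2" "u r"] by (simp add: z_def)
        then have "z r ^ (n + 2) \<le> 2 ^ (n + 2)" using z1 by (intro power_mono) auto
        then have "A / s * ((2 * real n + 3) * z r ^ (n + 2)) \<le> A / s * ((2 * real n + 3) * 2 ^ (n + 2))"
          using A s by (intro mult_left_mono) auto
        also have "\<dots> = \<kappa> / (4 * s)"
          using s by (simp add: A_def field_simps add_nonneg_eq_0_iff)
        also have "\<dots> < \<kappa> / (3 * s)"
          using \<kappa> s by (intro divide_strict_left_mono) auto
        finally show ?thesis
          using g2_le young_gap_nonneg[OF m \<rho>, of "g1 r"] by simp
      next
        case False
        have "\<bar>g1 r + p\<bar> = A * \<bar>y r\<bar> * z r ^ (n + 1)"
          using A z1 by (simp add: g1_def abs_mult)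
        also have "\<dots> \<ge> A * (1 / 2) * z r ^ (n + 1)"
          using A False z1 by (intro mult_right_mono mult_left_mono) auto
        finally have s_ge: "A / 2 * z r ^ (n + 1) \<le> \<bar>g1 r + p\<bar>" by simp
        moreover have "A / 2 * 1 \<le> A / 2 * z r ^ (n + 1)"
          using A z1 by (intro mult_left_mono one_le_power) auto
        ultimately have "A / 2 \<le> \<bar>g1 r + p\<bar>" by simp
        then have "c * \<bar>g1 r + p\<bar> powr m \<le> young_gap m \<rho> (g1 r)"
          by (rule coercive)
        moreover have "(A / 2) powr m * z r ^ (n + 2) \<le> \<bar>g1 r + p\<bar> powr m"
        proof -
          have "z r ^ (n + 2) = z r powr (real n + 2)"
            using z1 powr_realpow[of "z r" "n + 2"] by (simp add: add.commute)
          also have "\<dots> \<le> z r powr ((real n + 1) * m)"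
            using n(2) z1 by (intro powr_mono) (auto simp: algebra_simps)
          also have "\<dots> = (z r ^ (n + 1)) powr m"
            using z1 powr_realpow[of "z r" "n + 1"] by (simp add: powr_powr[symmetric] add.commute)
          finally have "(A / 2) powr m * z r ^ (n + 2) \<le> (A / 2) powr m * (z r ^ (n + 1)) powr m"
            by (intro mult_left_mono) auto
          also have "\<dots> = (A / 2 * z r ^ (n + 1)) powr m"
            by (rule powr_mult[symmetric])
          also have "\<dots> \<le> \<bar>g1 r + p\<bar> powr m"
            using s_ge A z1 m by (intro powr_mono2) auto
          finally show ?thesis .
        qed
        then have "c * ((A / 2) powr m * z r ^ (n + 2)) \<le> c * \<bar>g1 r + p\<bar> powr m"
          using c by (intro mult_left_mono) auto
        ultimately have gap: "c * ((A / 2) powr m * z r ^ (n + 2)) \<le> young_gap m \<rho> (g1 r)"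
          by linarith
        have "A * (2 * real n + 3) \<le> s * (c / 2 * (A / 2) powr m)"
          using s c A unfolding S_def by (simp add: pos_divide_le_eq)
        then have "A / s * (2 * real n + 3) \<le> c / 2 * (A / 2) powr m"
          using s by (simp add: field_simps)
        then have "A / s * (2 * real n + 3) * z r ^ (n + 2) \<le> c / 2 * (A / 2) powr m * z r ^ (n + 2)"
          using z1 by (intro mult_right_mono) auto
        also have "\<dots> = c * ((A / 2) powr m * z r ^ (n + 2)) / 2"
          by (simp only: mult.assoc times_divide_eq_left)
        also have "\<dots> \<le> young_gap m \<rho> (g1 r) / 2"
          by (rule divide_right_mono[OF gap]) simp
        finally have "g2 r \<le> young_gap m \<rho> (g1 r) / 2"
          using g2_le by (simp only: mult.assoc)
        then show ?thesis using \<kappa> s by (simp add: add.commute add_strict_increasing)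
      qed
    qed
    have lim: "filterlim g at_top F"
      if "(y \<longlongrightarrow> y0) F" "y0\<^sup>2 = 1" "((\<lambda>r. - p * r) \<longlongrightarrow> l) F" "\<forall>\<^sub>F r in F. r \<in> {s<..<3 * s}" for F y0 l
    proof -
      have "(u \<longlongrightarrow> 1 - y0\<^sup>2) F"
        unfolding u_def by (intro tendsto_intros that)
      then have "(u \<longlongrightarrow> 0) F" using that by simp
      moreover have "\<forall>\<^sub>F r in F. 0 < u r"
        using that(4) by (rule eventually_mono) (rule u_pos)
      ultimately have "filterlim z at_top F"
        unfolding z_def by (rule filterlim_inverse_at_top)
      then have "filterlim (\<lambda>r. z r ^ n) at_top F"
        using n(1) by (intro filterlim_pow_at_top)
      then have "filterlim (\<lambda>r. A * s / (2 * real n) * z r ^ n) at_top F"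
        using A s n(1) by (intro filterlim_tendsto_pos_mult_at_top[OF tendsto_const]) auto
      then show ?thesis
        unfolding g_def by (intro filterlim_tendsto_add_at_top[OF that(3)])
    qed
    have "filterlim g at_top (at_right s)"
    proof (rule lim)
      show "(y \<longlongrightarrow> (s - 2 * s) / s) (at_right s)" unfolding y_def using s by (intro tendsto_intros) auto
      show "((\<lambda>r. - p * r) \<longlongrightarrow> - p * s) (at_right s)" by (intro tendsto_intros)
      show "\<forall>\<^sub>F r in at_right s. r \<in> {s<..<3 * s}"
        using s by (intro eventually_at_right_real) auto
    qed (use s in \<open>simp add: power2_eq_square field_simps\<close>)
    moreover have "filterlim g at_top (at_left (3 * s))"
    proof (rule lim)
      show "(y \<longlongrightarrow> (3 * s - 2 * s) / s) (at_left (3 * s))" unfolding y_def using s by (intro tendsto_intros) auto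
      show "((\<lambda>r. - p * r) \<longlongrightarrow> - p * (3 * s)) (at_left (3 * s))" by (intro tendsto_intros)
      show "\<forall>\<^sub>F r in at_left (3 * s). r \<in> {s<..<3 * s}"
        using s by (intro eventually_at_left_real) auto
    qed (use s in \<open>simp add: power2_eq_square field_simps\<close>)
    ultimately show "\<exists>g g1 g2.
      (\<forall>r\<in>{s<..<3 * s}. (g has_real_derivative g1 r) (at r) \<and> (g1 has_real_derivative g2 r) (at r)
        \<and> g2 r < young_gap m \<rho> (g1 r) / 2 + \<kappa> / (3 * s))
      \<and> filterlim g at_top (at_right s) \<and> filterlim g at_top (at_left (3 * s))"
      using dg dg1 ineq by blast
  qed
qed

section \<open>Nonexistence of subsolutions\<close>

text \<open>
  At a touching point with the barrier, \<open>q\<close> is the common radial slope and the left-hand side of the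
  equation is at least
  \<open>lam' - lam_crit + young_gap q - g'' + (a - (d - 1)) q / r - \<beta> r\<^bsup>-\<eta>\<^esup>\<close>. Half of the gap and the forcing
  \<open>\<kappa> / (3 s)\<close> pay for \<open>g''\<close>. The other half enters the hypothesis, whose bound
  \<open>2 \<kappa> / r > 2 \<kappa> / (3 s)\<close> on the annulus leaves another \<open>\<kappa> / (3 s)\<close> by which \<open>lam'\<close> may fall short of
  \<open>lam\<close>. This uniform margin makes the conclusion survive the supremum over all subsolutions.
\<close>

lemma no_subsolution_near:
  fixes b :: "'a::euclidean_space \<Rightarrow> 'a"
  assumes m: "m > 1" and \<rho>: "\<rho> > 0" and \<kappa>: "\<kappa> > 0"
    and st: "structural_assms \<rho> R a \<eta> b V"
    and dominates: "\<forall>\<^sub>F r in at_top. \<forall>q. 2 * \<kappa> / r \<le> lam - lam_crit m \<rho> + young_gap m \<rho> q / 2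
      + (a - (real DIM('a) - 1)) * q / r - \<beta> * r powr (- \<eta>)"
  shows "\<exists>\<epsilon>>0. \<forall>lam' \<phi>. EP_subsolution m b V \<beta> lam' \<phi> \<longrightarrow> lam' < lam - \<epsilon>"
proof -
  define d where "d = real DIM('a) - 1"
  obtain N where N: "\<And>r q. N \<le> r \<Longrightarrow> 2 * \<kappa> / r \<le> lam - lam_crit m \<rho> + young_gap m \<rho> q / 2
      + (a - d) * q / r - \<beta> * r powr (- \<eta>)"
    using dominates unfolding eventually_at_top_linorder d_def by blast
  from eventually_happens'[OF trivial_limit_at_top_linorder eventually_conj[OF annulus_barrier[OF m \<rho> \<kappa>]
        eventually_ge_at_top[of "max N (max R 1)"]]]
  obtain s g g1 g2 where s': "s \<ge> max N (max R 1)"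
    and g_all: "\<forall>r\<in>{s<..<3 * s}. (g has_real_derivative g1 r) (at r) \<and>
      (g1 has_real_derivative g2 r) (at r) \<and> g2 r < young_gap m \<rho> (g1 r) / 2 + \<kappa> / (3 * s)"
    and lim: "filterlim g at_top (at_right s)" "filterlim g at_top (at_left (3 * s))"
    by blast
  have s: "s \<ge> N" "s \<ge> R" "s > 0" using s' by auto
  have g: "(g has_real_derivative g1 r) (at r)"
    and g1: "(g1 has_real_derivative g2 r) (at r)"
    and g2: "g2 r < young_gap m \<rho> (g1 r) / 2 + \<kappa> / (3 * s)" if "s < r" "r < 3 * s" for r
    using g_all that by simp_all
  have "lam' < lam - \<kappa> / (3 * s)" if sub: "EP_subsolution m b V \<beta> lam' \<phi>" for lam' \<phi>
  proof (rule ccontr)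
    assume "\<not> lam' < lam - \<kappa> / (3 * s)"
    then have lam': "lam' \<ge> lam - \<kappa> / (3 * s)" by simp
    have Ck: "Ck (Suc (Suc 1)) \<phi>" and le: "\<And>x. EP_lhs m b V \<beta> lam' \<phi> x \<le> 0"
      using sub by (auto simp: EP_subsolution_def numeral_3_eq_3)
    have "continuous_on {s<..<3 * s} g"
    proof (rule DERIV_continuous_on)
      fix r assume "r \<in> {s<..<3 * s}"
      then show "(g has_real_derivative g1 r) (at r within {s<..<3 * s})"
        by (intro has_field_derivative_at_within[OF g]) auto
    qed
    from annulus_touching_point[OF Ck_continuous[OF Ck] this _ _ lim] s
    obtain x where x: "s < norm x" "norm x < 3 * s"
      and max: "\<And>y. s < norm y \<Longrightarrow> norm y < 3 * s \<Longrightarrow> \<phi> y - g (norm y) \<le> \<phi> x - g (norm x)"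
      by auto
    define r q where "r = norm x" and "q = g1 r"
    have r: "r > 0" "r \<ge> N" "r \<ge> R" "r < 3 * s" using x s by (auto simp: r_def)
    have grad: "gradient \<phi> x = (q / r) *\<^sub>R x" and lap: "laplacian \<phi> x \<le> g2 r + d * (q / r)"
      using touching_radial[OF Ck x _ g g1[OF x] max] s by (simp_all add: r_def q_def d_def)
    have "x \<notin> ball 0 R" using r by (simp add: r_def)
    then have bx: "b x = ((\<rho> + a * inverse r) * inverse r) *\<^sub>R x" and Vx: "V x = r powr (- \<eta>)"
      using st by (auto simp: structural_assms_def r_def)
    have "x \<bullet> x = r * r" by (simp add: r_def norm_eq_sqrt_inner)
    then have drift: "b x \<bullet> gradient \<phi> x = \<rho> * q + a * q / r"
      using r by (simp add: bx grad field_simps)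
    have norm_grad: "norm (gradient \<phi> x) = \<bar>q\<bar>"
      using r by (simp add: grad flip: r_def)
    have "lam' - lam_crit m \<rho> - g2 r + young_gap m \<rho> q + (a - d) * q / r - \<beta> * r powr (- \<eta>) \<le> 0"
      using le[of x] lap
      by (simp add: EP_lhs_def drift norm_grad Vx young_gap_def diff_divide_distrib left_diff_distrib)
    moreover have "2 * \<kappa> / (3 * s) < 2 * \<kappa> / r"
      using r \<kappa> s by (intro divide_strict_left_mono) auto
    moreover have "2 * \<kappa> / (3 * s) = \<kappa> / (3 * s) + \<kappa> / (3 * s)"
      by simp
    ultimately show False
      using N[OF r(2), of q] g2[OF x, folded r_def, folded q_def] lam' by linarith
  qed
  then show ?thesis
    using \<kappa> s by (intro exI[of _ "\<kappa> / (3 * s)"]) auto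
qed

lemma young_gap_linear:
  assumes m: "m > 1" and \<rho>: "\<rho> > 0" and A: "A > 0"
  obtains C where "C > 0"
    and "\<And>q. A \<le> \<bar>q + crit_slope m \<rho>\<bar> \<Longrightarrow> C * \<bar>q + crit_slope m \<rho>\<bar> \<le> young_gap m \<rho> q"
proof -
  obtain c where c: "c > 0" "\<And>q. A \<le> \<bar>q + crit_slope m \<rho>\<bar> \<Longrightarrow>
      c * \<bar>q + crit_slope m \<rho>\<bar> powr m \<le> young_gap m \<rho> q"
    using young_gap_coercive[OF m \<rho> A] by blast
  show ?thesis
  proof (rule that[of "c * A powr (m - 1)"])
    show "c * A powr (m - 1) > 0" using c A by simp
    fix q define w where "w = \<bar>q + crit_slope m \<rho>\<bar>"
    assume q: "A \<le> \<bar>q + crit_slope m \<rho>\<bar>"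
    then have w: "A \<le> w" "w > 0" using A by (auto simp: w_def)
    have "A powr (m - 1) * w \<le> w powr (m - 1) * w"
      using w A m by (intro mult_right_mono powr_mono2) auto
    then have "A powr (m - 1) * w \<le> w powr m"
      using powr_eq_mult_powr_diff[OF w(2), of m] by (simp add: mult.commute)
    then have "c * (A powr (m - 1) * w) \<le> c * w powr m"
      using c(1) by simp
    then show "c * A powr (m - 1) * \<bar>q + crit_slope m \<rho>\<bar> \<le> young_gap m \<rho> q"
      using c(2)[OF q] by (simp add: w_def mult.assoc)
  qed
qed

text \<open>
  The first-order term \<open>\<alpha> q / r\<close> is dominated by the gap when \<open>q\<close> is far from the critical slope, and
  is \<open>O(1 / r)\<close> otherwise.
\<close>

lemma young_gap_drift_lower_bound:
  fixes \<alpha> :: real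
  assumes m: "m > 1" and \<rho>: "\<rho> > 0"
  shows "\<forall>\<^sub>F r in at_top. \<forall>q. - (\<bar>\<alpha>\<bar> * (crit_slope m \<rho> + 1)) / r \<le> young_gap m \<rho> q / 2 + \<alpha> * q / r"
proof -
  define p where "p = crit_slope m \<rho>"
  have p: "p > 0" using crit_slope_pos[OF \<rho>] by (simp add: p_def)
  obtain C where C: "C > 0" "\<And>q. 1 \<le> \<bar>q + p\<bar> \<Longrightarrow> C * \<bar>q + p\<bar> \<le> young_gap m \<rho> q"
    using young_gap_linear[OF m \<rho>, of 1] unfolding p_def by auto
  have "- (\<bar>\<alpha>\<bar> * (p + 1)) / r \<le> young_gap m \<rho> q / 2 + \<alpha> * q / r"
    if r: "r > 0" "r \<ge> 2 * \<bar>\<alpha>\<bar> * (p + 1) / C" for r q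
  proof -
    have abs: "- (\<bar>\<alpha>\<bar> * \<bar>q\<bar>) / r \<le> \<alpha> * q / r"
      using r(1) by (intro divide_right_mono) (auto simp flip: abs_mult)
    show ?thesis
    proof (cases "\<bar>q + p\<bar> \<le> 1")
      case True
      then have "\<bar>q\<bar> \<le> p + 1" using p by linarith
      then have "\<bar>\<alpha>\<bar> * \<bar>q\<bar> / r \<le> \<bar>\<alpha>\<bar> * (p + 1) / r"
        using r(1) by (intro divide_right_mono mult_left_mono) auto
      then show ?thesis
        using abs young_gap_nonneg[OF m \<rho>, of q] by simp
    next
      case False
      then have "p * 1 \<le> p * \<bar>q + p\<bar>"
        using p by (intro mult_left_mono) auto
      then have "\<bar>q\<bar> \<le> p * \<bar>q + p\<bar> + \<bar>q + p\<bar>"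
        using p by linarith
      then have "\<bar>q\<bar> \<le> (p + 1) * \<bar>q + p\<bar>"
        by (simp add: distrib_right)
      then have "\<bar>\<alpha>\<bar> * \<bar>q\<bar> \<le> \<bar>\<alpha>\<bar> * ((p + 1) * \<bar>q + p\<bar>)"
        by (intro mult_left_mono) auto
      also have "\<dots> \<le> r * C / 2 * \<bar>q + p\<bar>"
        using r C(1) mult_right_mono[of "\<bar>\<alpha>\<bar> * (p + 1)" "r * C / 2" "\<bar>q + p\<bar>"]
        by (simp add: field_simps)
      also have "\<dots> \<le> r * (young_gap m \<rho> q / 2)"
        using C(2)[of q] False r(1) by simp
      finally have "\<bar>\<alpha>\<bar> * \<bar>q\<bar> / r \<le> young_gap m \<rho> q / 2"
        using r(1) by (simp add: field_simps)
      moreover have "- (\<bar>\<alpha>\<bar> * (p + 1)) / r \<le> 0"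
        using r(1) p by (simp add: divide_nonpos_pos)
      ultimately show ?thesis using abs by simp
    qed
  qed
  then have "\<forall>r. r > max 0 (2 * \<bar>\<alpha>\<bar> * (p + 1) / C) \<longrightarrow>
      (\<forall>q. - (\<bar>\<alpha>\<bar> * (p + 1)) / r \<le> young_gap m \<rho> q / 2 + \<alpha> * q / r)"
    by simp
  then show ?thesis
    unfolding eventually_at_top_dense p_def by blast
qed

text \<open>
  When \<open>\<alpha> < 0\<close>, slopes near the critical one have the good sign: \<open>\<alpha> q / r\<close> is then of the exact order
  \<open>1 / r\<close> and positive. Slopes with the bad sign stay away from the critical slope, so the gap
  compensates for them.
\<close>

lemma young_gap_drift_positive:
  fixes \<alpha> :: real
  assumes m: "m > 1" and \<rho>: "\<rho> > 0" and \<alpha>: "\<alpha> < 0"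
  shows "\<forall>\<^sub>F r in at_top. \<forall>q. - \<alpha> * crit_slope m \<rho> / (2 * r) \<le> young_gap m \<rho> q / 2 + \<alpha> * q / r"
proof -
  define p where "p = crit_slope m \<rho>"
  have p: "p > 0" using crit_slope_pos[OF \<rho>] by (simp add: p_def)
  obtain C where C: "C > 0" "\<And>q. p / 2 \<le> \<bar>q + p\<bar> \<Longrightarrow> C * \<bar>q + p\<bar> \<le> young_gap m \<rho> q"
    using young_gap_linear[OF m \<rho>, of "p / 2"] p unfolding p_def by auto
  have "- \<alpha> * p / (2 * r) \<le> young_gap m \<rho> q / 2 + \<alpha> * q / r"
    if r: "r > 0" "r \<ge> 2 * (- \<alpha>) / C" for r q
  proof (cases "q \<le> - (p / 2)")
    case True
    then have "- \<alpha> * (p / 2) \<le> \<alpha> * q"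
      using \<alpha> mult_left_mono_neg[of q "- (p / 2)" \<alpha>] by simp
    then have "- \<alpha> * p / (2 * r) \<le> \<alpha> * q / r"
      using r(1) by (simp add: field_simps)
    then show ?thesis using young_gap_nonneg[OF m \<rho>, of q] by simp
  next
    case False
    have "- \<alpha> * (p / 2 + q) \<le> - \<alpha> * (q + p)"
      using \<alpha> p by (intro mult_left_mono) auto
    also have "\<dots> \<le> r * C / 2 * (q + p)"
      using r C(1) False p by (intro mult_right_mono) (auto simp: field_simps)
    also have "\<dots> \<le> r * (young_gap m \<rho> q / 2)"
      using C(2)[of q] False r(1) p by simp
    finally show ?thesis
      using r(1) by (simp add: field_simps)
  qed
  then have "\<forall>r. r > max 0 (2 * (- \<alpha>) / C) \<longrightarrow>
      (\<forall>q. - \<alpha> * p / (2 * r) \<le> young_gap m \<rho> q / 2 + \<alpha> * q / r)"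
    by simp
  then show ?thesis
    unfolding eventually_at_top_dense p_def by blast
qed

text \<open>
  An excess of \<open>lam\<close> over the critical value is a positive constant, against which all the terms that
  decay in \<open>r\<close> are negligible.
\<close>

lemma subsolution_le_lam_crit:
  fixes b :: "'a::euclidean_space \<Rightarrow> 'a"
  assumes m: "m > 1" and \<rho>: "\<rho> > 0" and \<eta>: "\<eta> > 0"
    and st: "structural_assms \<rho> R a \<eta> b V" and sub: "EP_subsolution m b V \<beta> lam \<phi>"
  shows "lam \<le> lam_crit m \<rho>"
proof (rule ccontr)
  assume *: "\<not> lam \<le> lam_crit m \<rho>"
  define \<alpha> where "\<alpha> = a - (real DIM('a) - 1)"
  define K where "K = \<bar>\<alpha>\<bar> * (crit_slope m \<rho> + 1)"
  have "((\<lambda>r. (2 + K) * inverse r + \<beta> * r powr (- \<eta>)) \<longlongrightarrow> (2 + K) * 0 + \<beta> * 0) at_top"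
    using \<eta> by (intro tendsto_intros tendsto_inverse_0_at_top tendsto_neg_powr filterlim_ident) auto
  then have small: "\<forall>\<^sub>F r in at_top. (2 + K) * inverse r + \<beta> * r powr (- \<eta>) < lam - lam_crit m \<rho>"
    using * by (intro order_tendstoD(2)) auto
  have "\<forall>\<^sub>F r in at_top. \<forall>q. 2 * 1 / r \<le> lam - lam_crit m \<rho> + young_gap m \<rho> q / 2
      + \<alpha> * q / r - \<beta> * r powr (- \<eta>)"
    using eventually_conj[OF small young_gap_drift_lower_bound[OF m \<rho>, of \<alpha>]]
  proof (rule eventually_mono, elim conjE, intro allI)
    fix r q
    assume "(2 + K) * inverse r + \<beta> * r powr (- \<eta>) < lam - lam_crit m \<rho>"
      and "\<forall>q. - (\<bar>\<alpha>\<bar> * (crit_slope m \<rho> + 1)) / r \<le> young_gap m \<rho> q / 2 + \<alpha> * q / r"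
    moreover from this(2) have "- K / r \<le> young_gap m \<rho> q / 2 + \<alpha> * q / r"
      by (simp add: K_def)
    moreover have "(2 + K) * inverse r = 2 / r - (- K / r)"
      by (simp add: divide_inverse algebra_simps)
    ultimately show "2 * 1 / r \<le> lam - lam_crit m \<rho> + young_gap m \<rho> q / 2
        + \<alpha> * q / r - \<beta> * r powr (- \<eta>)"
      by simp
  qed
  from no_subsolution_near[OF m \<rho> _ st this[unfolded \<alpha>_def]] sub show False
    by fastforce
qed

text \<open>
  Here the forcing comes from the drift itself: \<open>(a - (d - 1)) q / r\<close> contributes a positive multiple of
  \<open>1 / r\<close>, which beats \<open>\<beta> r\<^bsup>-\<eta>\<^esup>\<close> precisely because \<open>\<eta> > 1\<close>.
\<close>

lemma subsolution_strictly_below_lam_crit: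
  fixes b :: "'a::euclidean_space \<Rightarrow> 'a"
  assumes m: "m > 1" and \<rho>: "\<rho> > 0" and \<eta>: "\<eta> > 1" and a: "a < real DIM('a) - 1"
    and st: "structural_assms \<rho> R a \<eta> b V"
  shows "\<exists>\<epsilon>>0. \<forall>lam \<phi>. EP_subsolution m b V \<beta> lam \<phi> \<longrightarrow> lam < lam_crit m \<rho> - \<epsilon>"
proof -
  define \<alpha> where "\<alpha> = a - (real DIM('a) - 1)"
  define K where "K = - \<alpha> * crit_slope m \<rho>"
  have \<alpha>: "\<alpha> < 0" using a unfolding \<alpha>_def by linarith
  have K: "K > 0" using \<alpha> crit_slope_pos[OF \<rho>] unfolding K_def by (intro mult_pos_pos) auto
  have "((\<lambda>r. \<beta> * r powr (- (\<eta> - 1))) \<longlongrightarrow> \<beta> * 0) at_top"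
    using \<eta> by (intro tendsto_intros tendsto_neg_powr filterlim_ident) auto
  then have small: "\<forall>\<^sub>F r in at_top. \<beta> * r powr (- (\<eta> - 1)) < K / 4"
    using K by (intro order_tendstoD(2)) auto
  have "\<forall>\<^sub>F r in at_top. \<forall>q. 2 * (K / 8) / r \<le> lam_crit m \<rho> - lam_crit m \<rho> + young_gap m \<rho> q / 2
      + \<alpha> * q / r - \<beta> * r powr (- \<eta>)"
    using eventually_conj[OF eventually_gt_at_top[of 0]
        eventually_conj[OF small young_gap_drift_positive[OF m \<rho> \<alpha>]]]
  proof (rule eventually_mono, elim conjE, intro allI)
    fix r q :: real
    assume r: "r > 0" and "\<beta> * r powr (- (\<eta> - 1)) < K / 4"
      and *: "\<forall>q. - \<alpha> * crit_slope m \<rho> / (2 * r) \<le> young_gap m \<rho> q / 2 + \<alpha> * q / r"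
    have "r powr (- (\<eta> - 1)) = r * r powr (- \<eta>)"
      using powr_eq_mult_powr_diff[OF r, of "- (\<eta> - 1)"] by simp
    with \<open>\<beta> * r powr (- (\<eta> - 1)) < K / 4\<close> have "\<beta> * r powr (- \<eta>) < K / (4 * r)"
      using r by (simp add: field_simps)
    moreover have "K / (2 * r) \<le> young_gap m \<rho> q / 2 + \<alpha> * q / r"
      using * by (simp add: K_def)
    moreover have "K / (2 * r) - K / (4 * r) = 2 * (K / 8) / r"
      using r by (simp add: field_simps)
    ultimately show "2 * (K / 8) / r \<le> lam_crit m \<rho> - lam_crit m \<rho> + young_gap m \<rho> q / 2
        + \<alpha> * q / r - \<beta> * r powr (- \<eta>)"
      by simp
  qed
  from no_subsolution_near[OF m \<rho> _ st this[unfolded \<alpha>_def]] K show ?thesis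
    by simp
qed

section \<open>Explicit subsolutions\<close>

lemma DERIV_glue:
  fixes f g :: "real \<Rightarrow> real"
  assumes f: "\<And>x. x \<le> c \<Longrightarrow> (f has_real_derivative f' x) (at x)"
    and g: "\<And>x. c \<le> x \<Longrightarrow> (g has_real_derivative g' x) (at x)"
    and eq: "f c = g c" "f' c = g' c"
  shows "((\<lambda>x. if x \<le> c then f x else g x) has_real_derivative (if x \<le> c then f' x else g' x)) (at x)"
proof -
  have f': "(f has_vector_derivative f' x) (at x within S)" if "x \<le> c" for x S
    using f[OF that] by (simp add: has_real_derivative_iff_has_vector_derivative has_vector_derivative_at_within)
  have g': "(g has_vector_derivative g' x) (at x within S)" if "c \<le> x" for x S
    using g[OF that] by (simp add: has_real_derivative_iff_has_vector_derivative has_vector_derivative_at_within)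
  have "((\<lambda>x. if x \<in> {..c} then f x else g x) has_vector_derivative
      (if x \<in> {..c} then f' x else g' x)) (at x within UNIV)"
    by (rule has_vector_derivative_If_within_closures[where T = "{c<..}"])
      (use eq in \<open>auto intro!: f' g'\<close>)
  then show ?thesis
    by (simp add: has_real_derivative_iff_has_vector_derivative)
qed

text \<open>
  The square root on \<open>[1, \<infinity>)\<close> is continued to the left of \<open>1\<close> by its Taylor polynomial of degree three
  at \<open>1\<close>; all derivatives up to the third match there.
\<close>

lemma sqrt_C3_extension:
  obtains f0 f1 f2 f3 :: "real \<Rightarrow> real"
  where "\<And>s. (f0 has_real_derivative f1 s) (at s)" "\<And>s. (f1 has_real_derivative f2 s) (at s)"
    and "\<And>s. (f2 has_real_derivative f3 s) (at s)" "continuous_on UNIV f3"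
    and "\<And>s. 1 \<le> s \<Longrightarrow> f1 s = s powr (- 1 / 2) / 2"
    and "\<And>s. 1 \<le> s \<Longrightarrow> f2 s = - (s powr (- 3 / 2)) / 4"
proof -
  define f0 where "f0 = (\<lambda>s::real. if s \<le> 1 then 1 + (s - 1) / 2 - (s - 1)\<^sup>2 / 8 + (s - 1) ^ 3 / 16
    else s powr (1 / 2))"
  define f1 where "f1 = (\<lambda>s::real. if s \<le> 1 then 1 / 2 - (s - 1) / 4 + 3 * (s - 1)\<^sup>2 / 16
    else s powr (- 1 / 2) / 2)"
  define f2 where "f2 = (\<lambda>s::real. if s \<le> 1 then - 1 / 4 + 3 * (s - 1) / 8
    else - (s powr (- 3 / 2)) / 4)"
  define f3 where "f3 = (\<lambda>s::real. if s \<le> 1 then 3 / 8 else 3 * s powr (- 5 / 2) / 8)"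
  have "(f0 has_real_derivative f1 s) (at s)" for s
    unfolding f0_def f1_def
    by (rule DERIV_glue) (auto intro!: derivative_eq_intros)
  moreover have "(f1 has_real_derivative f2 s) (at s)" for s
    unfolding f1_def f2_def
    by (rule DERIV_glue) (auto intro!: derivative_eq_intros)
  moreover have "(f2 has_real_derivative f3 s) (at s)" for s
    unfolding f2_def f3_def
    by (rule DERIV_glue) (auto intro!: derivative_eq_intros)
  moreover have f3_eq: "f3 = (\<lambda>s. 3 * (max s 1) powr (- 5 / 2) / 8)"
    by (auto simp: f3_def max_def)
  have "max s 1 \<noteq> 0" for s :: real
    by linarith
  then have "continuous_on UNIV (\<lambda>s::real. 3 * (max s 1) powr (- 5 / 2) / 8)"
    by (intro continuous_intros) auto
  then have "continuous_on UNIV f3"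
    unfolding f3_eq .
  ultimately show ?thesis
    by (intro that[of f0 f1 f2 f3]) (auto simp: f1_def f2_def)
qed

text \<open>
  Composing with \<open>x \<bullet> x\<close> instead of \<open>norm x\<close> keeps smoothness at the origin.
\<close>

lemma radial_C3:
  fixes f0 f1 f2 f3 :: "real \<Rightarrow> real"
  assumes f: "\<And>s. (f0 has_real_derivative f1 s) (at s)" "\<And>s. (f1 has_real_derivative f2 s) (at s)"
      "\<And>s. (f2 has_real_derivative f3 s) (at s)" and f3: "continuous_on UNIV f3"
  defines "\<phi> \<equiv> \<lambda>x::'a::euclidean_space. f0 (x \<bullet> x)"
  shows "Ck 3 \<phi>" and "gradient \<phi> x = (2 * f1 (x \<bullet> x)) *\<^sub>R x"
    and "laplacian \<phi> x = 4 * (x \<bullet> x) * f2 (x \<bullet> x) + 2 * real DIM('a) * f1 (x \<bullet> x)"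
proof -
  have comp: "((\<lambda>x::'a. g (x \<bullet> x)) has_derivative (\<lambda>w. 2 * (w \<bullet> x) * g' (x \<bullet> x))) (at x)"
    if "\<And>s. (g has_real_derivative g' s) (at s)" for g g' :: "real \<Rightarrow> real" and x :: 'a
  proof -
    have "((\<lambda>x::'a. x \<bullet> x) has_derivative (\<lambda>w. 2 * (w \<bullet> x))) (at x)"
      by (auto intro!: derivative_eq_intros simp: inner_commute)
    from DERIV_compose_FDERIV[OF that this] show ?thesis .
  qed
  define D1 where "D1 = (\<lambda>v x::'a. 2 * (v \<bullet> x) * f1 (x \<bullet> x))"
  define D2 where "D2 = (\<lambda>v w x::'a. 4 * (v \<bullet> x) * (w \<bullet> x) * f2 (x \<bullet> x) + 2 * (v \<bullet> w) * f1 (x \<bullet> x))"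
  define D3 where "D3 = (\<lambda>v w u x::'a. 8 * (v \<bullet> x) * (w \<bullet> x) * (u \<bullet> x) * f3 (x \<bullet> x)
    + 4 * ((v \<bullet> u) * (w \<bullet> x) + (v \<bullet> x) * (w \<bullet> u) + (v \<bullet> w) * (u \<bullet> x)) * f2 (x \<bullet> x))"
  have d1: "(\<phi> has_derivative (\<lambda>v. D1 v x)) (at x)" for x
    unfolding \<phi>_def D1_def by (rule comp[OF f(1)])
  have d2: "(D1 v has_derivative (\<lambda>w. D2 v w x)) (at x)" for v x
    unfolding D1_def D2_def
    by (rule derivative_eq_intros comp[OF f(2)] refl)+ (auto simp: algebra_simps)
  have d3: "(D2 v w has_derivative (\<lambda>u. D3 v w u x)) (at x)" for v w x
    unfolding D2_def D3_def
    by (rule derivative_eq_intros comp[OF f(2)] comp[OF f(3)] refl)+ (auto simp: algebra_simps)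
  have "continuous_on UNIV f2"
    using DERIV_isCont[OF f(3)] by (simp add: continuous_at_imp_continuous_on)
  then have "continuous_on UNIV (\<lambda>x::'a. f2 (x \<bullet> x))" "continuous_on UNIV (\<lambda>x::'a. f3 (x \<bullet> x))"
    using f3 by (auto intro!: continuous_on_compose2[of UNIV _ UNIV "\<lambda>x. x \<bullet> x"] continuous_intros)
  then have "Ck 0 (D3 v w u)" for v w u
    unfolding D3_def Ck.simps(1)
    by (intro continuous_on_add continuous_on_mult continuous_on_const continuous_on_inner
        continuous_on_id)
  then have "Ck (Suc (Suc (Suc 0))) \<phi>"
    by (intro Ck_SucI[OF d1] Ck_SucI[OF d2] Ck_SucI[OF d3])
  then show Ck: "Ck 3 \<phi>"
    by (simp only: numeral_3_eq_3)
  have F1: "frechet_derivative \<phi> (at x) = (\<lambda>v. D1 v x)" for x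
    by (rule frechet_derivative_at[OF d1, symmetric])
  have F2: "frechet_derivative (D1 v) (at x) = (\<lambda>w. D2 v w x)" for v x
    by (rule frechet_derivative_at[OF d2, symmetric])
  show "gradient \<phi> x = (2 * f1 (x \<bullet> x)) *\<^sub>R x"
    by (rule gradient_eqI) (use d1 in \<open>simp add: gderiv_def D1_def mult_ac\<close>)
  have "laplacian \<phi> x = (\<Sum>i\<in>Basis. 4 * f2 (x \<bullet> x) * ((x \<bullet> i) * (x \<bullet> i)) + 2 * f1 (x \<bullet> x))"
    unfolding laplacian_def F1
    by (intro sum.cong refl) (simp add: F2[unfolded D1_def] D2_def F2 inner_commute inner_same_Basis)
  also have "\<dots> = 4 * (x \<bullet> x) * f2 (x \<bullet> x) + 2 * real DIM('a) * f1 (x \<bullet> x)"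
    by (simp add: sum.distrib euclidean_inner[of x x] flip: sum_distrib_left)
  finally show "laplacian \<phi> x = 4 * (x \<bullet> x) * f2 (x \<bullet> x) + 2 * real DIM('a) * f1 (x \<bullet> x)" .
qed

text \<open>
  The function is exactly \<open>- p norm x\<close> outside the unit ball. An approximation such as
  \<open>- p sqrt (1 + norm x\<^sup>2)\<close> would leave lower-order errors of the wrong sign, which cannot be absorbed
  when \<open>a = d - 1\<close> and \<open>\<eta>\<close> is large.
\<close>

lemma smoothed_cone:
  fixes p :: real
  obtains \<phi> :: "'a::euclidean_space \<Rightarrow> real" where "Ck 3 \<phi>"
    and "\<And>x. 1 \<le> norm x \<Longrightarrow> gradient \<phi> x = (- p / norm x) *\<^sub>R x"
    and "\<And>x. 1 \<le> norm x \<Longrightarrow> laplacian \<phi> x = - p * (real DIM('a) - 1) / norm x"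
proof -
  obtain f0 f1 f2 f3 :: "real \<Rightarrow> real"
    where f: "\<And>s. (f0 has_real_derivative f1 s) (at s)" "\<And>s. (f1 has_real_derivative f2 s) (at s)"
      "\<And>s. (f2 has_real_derivative f3 s) (at s)" "continuous_on UNIV f3"
      and f1: "\<And>s. 1 \<le> s \<Longrightarrow> f1 s = s powr (- 1 / 2) / 2"
      and f2: "\<And>s. 1 \<le> s \<Longrightarrow> f2 s = - (s powr (- 3 / 2)) / 4"
    using sqrt_C3_extension by blast
  define \<phi> where "\<phi> = (\<lambda>x::'a. - p * f0 (x \<bullet> x))"
  have cont: "continuous_on UNIV (\<lambda>s. - p * f3 s)"
    using f(4) by (intro continuous_intros)
  have radial: "Ck 3 \<phi>" "gradient \<phi> x = (2 * (- p * f1 (x \<bullet> x))) *\<^sub>R x"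
    "laplacian \<phi> x = 4 * (x \<bullet> x) * (- p * f2 (x \<bullet> x)) + 2 * real DIM('a) * (- p * f1 (x \<bullet> x))" for x
    unfolding \<phi>_def by (rule radial_C3[OF DERIV_cmult[OF f(1)] DERIV_cmult[OF f(2)] DERIV_cmult[OF f(3)] cont])+
  have vals: "f1 (x \<bullet> x) = 1 / (2 * norm x)" "f2 (x \<bullet> x) = - 1 / (4 * norm x ^ 3)"
    if "1 \<le> norm x" for x :: 'a
  proof -
    have pos: "norm x > 0" using that by linarith
    define r where "r = norm x"
    have r: "r > 0" using pos by (simp add: r_def)
    have xx: "x \<bullet> x = r powr 2" using r by (simp add: r_def power2_norm_eq_inner)
    have ge: "1 \<le> x \<bullet> x" using that by (simp flip: power2_norm_eq_inner)
    have "(r powr 2) powr (- 1 / 2) = 1 / r" "(r powr 2) powr (- 3 / 2) = 1 / r ^ 3"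
      unfolding powr_powr using r by (simp_all add: powr_minus_divide)
    then show "f1 (x \<bullet> x) = 1 / (2 * norm x)" "f2 (x \<bullet> x) = - 1 / (4 * norm x ^ 3)"
      using f1[OF ge] f2[OF ge] unfolding xx r_def[symmetric] by simp_all
  qed
  show ?thesis
  proof (rule that[of \<phi>])
    show "Ck 3 \<phi>" by (rule radial)
    fix x :: 'a assume x: "1 \<le> norm x"
    then have pos: "norm x > 0" by linarith
    show "gradient \<phi> x = (- p / norm x) *\<^sub>R x"
      unfolding radial(2) vals[OF x] by simp
    have "laplacian \<phi> x = 4 * (norm x)\<^sup>2 * (- p * (- 1 / (4 * norm x ^ 3)))
        + 2 * real DIM('a) * (- p * (1 / (2 * norm x)))"
      unfolding radial(3) vals[OF x] by (simp add: power2_norm_eq_inner)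
    also have "\<dots> = - p * (real DIM('a) - 1) / norm x"
      using pos by (simp add: field_simps power2_eq_square power3_eq_cube)
    finally show "laplacian \<phi> x = - p * (real DIM('a) - 1) / norm x" .
  qed
qed

text \<open>
  Far out, the cone with slope \<open>- crit_slope\<close> turns the equation into the explicit inequality \<open>far\<close>,
  the gap being zero. On the remaining ball \<open>V\<close> is bounded below by a positive constant, and a large
  \<open>\<beta>\<close> makes \<open>- \<beta> V\<close> dominate everything else.
\<close>

lemma subsolution_exists:
  fixes b :: "'a::euclidean_space \<Rightarrow> 'a"
  assumes m: "m > 1" and \<rho>: "\<rho> > 0" and R: "R > 0" and st: "structural_assms \<rho> R a \<eta> b V"
    and far: "\<And>\<beta> r. B \<le> \<beta> \<Longrightarrow> S \<le> r \<Longrightarrow>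
      lam - lam_crit m \<rho> - (a - (real DIM('a) - 1)) * crit_slope m \<rho> / r - \<beta> * r powr (- \<eta>) \<le> 0"
  shows "\<exists>\<beta>0. \<forall>\<beta>\<ge>\<beta>0. \<exists>\<phi>. EP_subsolution m b V \<beta> lam \<phi>"
proof -
  define p where "p = crit_slope m \<rho>"
  have p: "p > 0" using crit_slope_pos[OF \<rho>] by (simp add: p_def)
  obtain \<phi> :: "'a \<Rightarrow> real" where Ck: "Ck 3 \<phi>"
    and grad: "\<And>x. 1 \<le> norm x \<Longrightarrow> gradient \<phi> x = (- p / norm x) *\<^sub>R x"
    and lap: "\<And>x. 1 \<le> norm x \<Longrightarrow> laplacian \<phi> x = - p * (real DIM('a) - 1) / norm x"
    using smoothed_cone by blast
  define T where "T = max S (max R 1)"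
  have bV: "continuous_on UNIV b" "continuous_on UNIV V"
    using st by (auto simp: structural_assms_def intro: Ck_continuous)
  have Ck': "Ck (Suc (Suc (Suc 0))) \<phi>" using Ck by (simp only: numeral_3_eq_3)
  have cont: "continuous_on UNIV (EP_lhs m b V 0 lam \<phi>)"
    unfolding EP_lhs_def[abs_def]
    using m bV by (intro continuous_intros continuous_laplacian[OF Ck'] continuous_gradient[OF Ck']
        continuous_on_powr') auto
  have "\<exists>x\<in>cball 0 T. \<forall>y\<in>cball 0 T. EP_lhs m b V 0 lam \<phi> y \<le> EP_lhs m b V 0 lam \<phi> x"
    by (intro continuous_attains_sup continuous_on_subset[OF cont]) (auto simp: T_def)
  then obtain M where M: "\<And>y. norm y \<le> T \<Longrightarrow> EP_lhs m b V 0 lam \<phi> y \<le> M"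
    by (metis mem_cball_0)
  have V_pos: "V x > 0" for x
  proof (cases "x \<in> ball 0 R")
    case True
    then have "x \<in> closure (ball 0 R)"
      using closure_subset by blast
    then show ?thesis
      using st unfolding structural_assms_def by blast
  next
    case False
    then have "V x = norm x powr (- \<eta>)" and "x \<noteq> 0"
      using st R by (auto simp: structural_assms_def)
    then show ?thesis by simp
  qed
  have "\<exists>x\<in>cball 0 T. \<forall>y\<in>cball 0 T. V x \<le> V y"
    by (intro continuous_attains_inf continuous_on_subset[OF bV(2)]) (auto simp: T_def)
  then obtain v where v: "v > 0" "\<And>y. norm y \<le> T \<Longrightarrow> v \<le> V y"
    using V_pos by (metis mem_cball_0)
  show ?thesis
  proof (intro exI[of _ "max B (max 0 (M / v))"] allI impI exI[of _ \<phi>])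
    fix \<beta> assume \<beta>: "max B (max 0 (M / v)) \<le> \<beta>"
    show "EP_subsolution m b V \<beta> lam \<phi>"
      unfolding EP_subsolution_def
    proof (intro conjI allI Ck)
      fix x
      show "EP_lhs m b V \<beta> lam \<phi> x \<le> 0"
      proof (cases "norm x \<le> T")
        case True
        have "M \<le> \<beta> * v" using \<beta> v(1) by (simp add: pos_divide_le_eq)
        also have "\<dots> \<le> \<beta> * V x" using v(2)[OF True] \<beta> by (intro mult_left_mono) auto
        finally show ?thesis
          using M[OF True] by (simp add: EP_lhs_def)
      next
        case False
        define r where "r = norm x"
        have r: "r > 0" "r \<ge> 1" "r \<ge> R" "r \<ge> S" using False by (auto simp: r_def T_def)
        have "x \<notin> ball 0 R" using r by (simp add: r_def)
        then have bx: "b x = ((\<rho> + a * inverse r) * inverse r) *\<^sub>R x" and Vx: "V x = r powr (- \<eta>)"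
          using st by (auto simp: structural_assms_def r_def)
        have g: "gradient \<phi> x = (- p / r) *\<^sub>R x" and l: "laplacian \<phi> x = - p * (real DIM('a) - 1) / r"
          using grad[of x] lap[of x] r by (auto simp: r_def)
        have "x \<bullet> x = r * r" by (simp add: r_def norm_eq_sqrt_inner)
        then have drift: "b x \<bullet> gradient \<phi> x = - \<rho> * p - a * p / r"
          using r by (simp add: bx g field_simps)
        have norm_grad: "norm (gradient \<phi> x) = p"
          using r p by (simp add: g flip: r_def)
        have "EP_lhs m b V \<beta> lam \<phi> x
            = lam - lam_crit m \<rho> - (a - (real DIM('a) - 1)) * p / r - \<beta> * r powr (- \<eta>)"
          unfolding EP_lhs_def norm_grad drift l Vx lam_crit_eq[OF m \<rho>] p_def[symmetric]
          using r by (simp add: field_simps)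
        also have "\<dots> \<le> 0" using far[of \<beta> r] r \<beta> by (simp add: p_def)
        finally show ?thesis .
      qed
    qed
  qed
qed

section \<open>The limit of the generalized principal eigenvalue\<close>

lemma lambda_max_leI:
  assumes "\<And>lam \<phi>. EP_subsolution m b V \<beta> lam \<phi> \<Longrightarrow> lam \<le> L"
  shows "lambda_max m b V \<beta> \<le> ereal L"
  unfolding lambda_max_def using assms by (intro Sup_least) auto

lemma lambda_max_geI:
  assumes "EP_subsolution m b V \<beta> lam \<phi>"
  shows "ereal lam \<le> lambda_max m b V \<beta>"
  unfolding lambda_max_def using assms by (intro Sup_upper) auto

theorem theorem4p6:
  fixes b :: "'a::euclidean_space \<Rightarrow> 'a" and V :: "'a \<Rightarrow> real"
    and m \<rho> R a \<eta> :: real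
  assumes "m > 1" and "\<rho> > 0" and "R > 0" and "\<eta> > 0"
    and "structural_assms \<rho> R a \<eta> b V"
  shows "(lambda_max m b V \<longlongrightarrow> lambda_bar m b V) at_top
    \<and> lambda_bar m b V = ereal (\<rho> powr conj_exponent m / conj_exponent m)
    \<and> (\<eta> \<le> 1 \<or> a \<ge> real DIM('a) - 1 \<longrightarrow>
         (\<exists>\<beta>\<^sub>0>0. \<forall>\<beta>\<ge>\<beta>\<^sub>0. lambda_max m b V \<beta> = lambda_bar m b V))
    \<and> (\<eta> > 1 \<and> a < real DIM('a) - 1 \<longrightarrow>
         (\<forall>\<beta>\<ge>0. lambda_max m b V \<beta> < lambda_bar m b V))"
proof -
  define L where "L = lam_crit m \<rho>"
  define p where "p = crit_slope m \<rho>"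
  define \<alpha> where "\<alpha> = a - (real DIM('a) - 1)"
  note m = \<open>m > 1\<close> and \<rho> = \<open>\<rho> > 0\<close> and st = assms(5)
  note exists = subsolution_exists[OF m \<rho> \<open>R > 0\<close> st, folded \<alpha>_def L_def p_def]
  have p: "p > 0" using crit_slope_pos[OF \<rho>] by (simp add: p_def)
  have upper: "lambda_max m b V \<beta> \<le> ereal L" for \<beta>
    unfolding L_def by (intro lambda_max_leI) (rule subsolution_le_lam_crit[OF m \<rho> \<open>\<eta> > 0\<close> st])
  have lower: "\<forall>\<^sub>F \<beta> in at_top. ereal (L - \<epsilon>) \<le> lambda_max m b V \<beta>" if \<epsilon>: "\<epsilon> > 0" for \<epsilon>
  proof -
    have "(L - \<epsilon>) - L - \<alpha> * p / r - \<beta> * r powr (- \<eta>) \<le> 0"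
      if "0 \<le> \<beta>" "max 1 (\<bar>\<alpha>\<bar> * p / \<epsilon>) \<le> r" for \<beta> r
    proof -
      have r: "r > 0" "\<bar>\<alpha>\<bar> * p \<le> r * \<epsilon>"
        using that(2) \<epsilon> by (auto simp: pos_divide_le_eq)
      have "- \<alpha> * p \<le> \<bar>\<alpha>\<bar> * p"
        using p by (intro mult_right_mono) auto
      also have "\<dots> \<le> \<epsilon> * r"
        using r(2) by (simp add: mult.commute)
      finally have "- \<alpha> * p / r \<le> \<epsilon>"
        by (subst pos_divide_le_eq[OF r(1)])
      moreover have "0 \<le> \<beta> * r powr (- \<eta>)"
        using that(1) by simp
      ultimately show ?thesis by simp
    qed
    from exists[OF this] obtain \<beta>0 where "\<And>\<beta>. \<beta> \<ge> \<beta>0 \<Longrightarrow> \<exists>\<phi>. EP_subsolution m b V \<beta> (L - \<epsilon>) \<phi>"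
      by blast
    then show ?thesis
      using lambda_max_geI unfolding eventually_at_top_linorder by blast
  qed
  have lim: "(lambda_max m b V \<longlongrightarrow> ereal L) at_top"
  proof (rule order_tendstoI)
    fix l assume "l < ereal L"
    then obtain z where z: "l < ereal z" "z < L"
      using ereal_dense2[of l "ereal L"] by auto
    have "\<forall>\<^sub>F \<beta> in at_top. ereal (L - (L - z)) \<le> lambda_max m b V \<beta>"
      using z by (intro lower) simp
    then show "\<forall>\<^sub>F \<beta> in at_top. l < lambda_max m b V \<beta>"
      by (rule eventually_mono) (use z in \<open>simp add: less_le_trans\<close>)
  next
    fix u assume "ereal L < u"
    then show "\<forall>\<^sub>F \<beta> in at_top. lambda_max m b V \<beta> < u"
      using upper le_less_trans by (intro always_eventually allI) blast
  qed
  then have bar: "lambda_bar m b V = ereal L"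
    unfolding lambda_bar_def by (intro tendsto_Lim) auto
  have attained: "\<exists>\<beta>\<^sub>0>0. \<forall>\<beta>\<ge>\<beta>\<^sub>0. lambda_max m b V \<beta> = ereal L"
    if cases: "\<eta> \<le> 1 \<or> a \<ge> real DIM('a) - 1"
  proof -
    have "L - L - \<alpha> * p / r - \<beta> * r powr (- \<eta>) \<le> 0" if "\<bar>\<alpha>\<bar> * p \<le> \<beta>" "1 \<le> r" for \<beta> r
    proof (cases "\<alpha> \<ge> 0")
      case True
      have "\<beta> \<ge> 0" using that(1) p by (meson abs_ge_zero less_imp_le mult_nonneg_nonneg order_trans)
      then have "\<beta> * r powr (- \<eta>) \<ge> 0" by simp
      moreover have "\<alpha> * p / r \<ge> 0" using True p that(2) by simp
      ultimately show ?thesis by linarith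
    next
      case False
      then have "\<eta> \<le> 1" using cases unfolding \<alpha>_def by linarith
      have "- \<alpha> * p / r = \<bar>\<alpha>\<bar> * p * r powr (- 1)"
        using False that(2) by (simp add: powr_minus divide_inverse)
      also have "\<dots> \<le> \<bar>\<alpha>\<bar> * p * r powr (- \<eta>)"
        using \<open>\<eta> \<le> 1\<close> that(2) p by (intro mult_left_mono powr_mono) auto
      also have "\<dots> \<le> \<beta> * r powr (- \<eta>)"
        using that(1) by (intro mult_right_mono) auto
      finally show ?thesis by simp
    qed
    from exists[OF this] obtain \<beta>0 where "\<And>\<beta>. \<beta> \<ge> \<beta>0 \<Longrightarrow> \<exists>\<phi>. EP_subsolution m b V \<beta> L \<phi>"
      by blast
    then have "lambda_max m b V \<beta> = ereal L" if "\<beta> \<ge> max \<beta>0 1" for \<beta>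
      using that lambda_max_geI upper by (meson antisym max.boundedE)
    then show ?thesis
      by (intro exI[of _ "max \<beta>0 1"]) auto
  qed
  have strict: "lambda_max m b V \<beta> < ereal L" if \<eta>1: "\<eta> > 1" and a: "a < real DIM('a) - 1" for \<beta>
  proof -
    obtain \<epsilon> where \<epsilon>: "\<epsilon> > 0" "\<And>lam \<phi>. EP_subsolution m b V \<beta> lam \<phi> \<Longrightarrow> lam < L - \<epsilon>"
      using subsolution_strictly_below_lam_crit[OF m \<rho> \<eta>1 a st, of \<beta>] unfolding L_def by blast
    have "lambda_max m b V \<beta> \<le> ereal (L - \<epsilon>)"
      using \<epsilon>(2) by (intro lambda_max_leI less_imp_le)
    also have "\<dots> < ereal L" using \<epsilon>(1) by simp
    finally show ?thesis .
  qed
  show ?thesis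
    unfolding bar using lim attained strict
    by (simp add: L_def lam_crit_def)
qed

end
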